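(* Let $\mathcal{A}$ and $\mathcal{B}$ be $AW^*$-algebras. Then $\mathcal{A}^{sa}$ and $\mathcal{B}^{++}$ are order isomorphic if and only if $\mathcal{A}$ and $\mathcal{B}$ are Jordan $^*$-isomorphic and $\mathcal{A}$ is commutative.
   Context: All $C^*$-algebras are unital; $\mathcal{A}^{sa}$ denotes self-adjoint elements and $\mathcal{B}^{++}$ positive invertible elements, both with order $a\le b\iff b-a\ge0$. Order isomorphic means there is a bijection preserving order in both directions. A Jordan $^*$-isomorphism is a linear bijection $J$ with $J(a^* )=J(a)^*$ and $J(ab+ba)=J(a)J(b)+J(b)J(a)$. An $AW^*$-algebra is a $C^*$-algebra $\mathcal{A}$ such that for every nonempty $\mathcal{F}\subseteq\mathcal{A}$ there is a projection $p$ with $\{a:ba=0\ \forall b\in\mathcal{F}\}=p\mathcal{A}$. *)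

theory Defs
  imports Complex_Main
begin

class cstar_algebra = real_normed_algebra_1 + banach +
  fixes scaleC :: "complex \<Rightarrow> 'a \<Rightarrow> 'a"
    and cstar :: "'a \<Rightarrow> 'a"
  assumes scaleC_add_right: "scaleC c (x + y) = scaleC c x + scaleC c y"
    and scaleC_add_left: "scaleC (c + d) x = scaleC c x + scaleC d x"
    and scaleC_scaleC: "scaleC c (scaleC d x) = scaleC (c * d) x"
    and scaleC_one: "scaleC 1 x = x"
    and scaleR_scaleC: "scaleR r x = scaleC (complex_of_real r) x"
    and norm_scaleC: "norm (scaleC c x) = cmod c * norm x"
    and mult_scaleC_left: "scaleC c x * y = scaleC c (x * y)"
    and mult_scaleC_right: "x * scaleC c y = scaleC c (x * y)"
    and cstar_cstar: "cstar (cstar x) = x"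
    and cstar_add: "cstar (x + y) = cstar x + cstar y"
    and cstar_mult: "cstar (x * y) = cstar y * cstar x"
    and cstar_scaleC: "cstar (scaleC c x) = scaleC (cnj c) (cstar x)"
    and cstar_identity: "norm (cstar x * x) = norm x ^ 2"

definition invertible_el :: "'a::cstar_algebra \<Rightarrow> bool" where
  "invertible_el a \<longleftrightarrow> (\<exists>b. a * b = 1 \<and> b * a = 1)"

definition cspectrum :: "'a::cstar_algebra \<Rightarrow> complex set" where
  "cspectrum a = {z. \<not> invertible_el (a - scaleC z 1)}"

definition self_adjoint_part :: "'a::cstar_algebra set" where
  "self_adjoint_part = {a. cstar a = a}"

definition positive_el :: "'a::cstar_algebra \<Rightarrow> bool" where
  "positive_el a \<longleftrightarrow> cstar a = a \<and> cspectrum a \<subseteq> {z. Im z = 0 \<and> Re z \<ge> 0}"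

definition cstar_le :: "'a::cstar_algebra \<Rightarrow> 'a \<Rightarrow> bool" where
  "cstar_le a b \<longleftrightarrow> positive_el (b - a)"

definition positive_invertible_part :: "'a::cstar_algebra set" where
  "positive_invertible_part = {a. positive_el a \<and> invertible_el a}"

definition order_isomorphic :: "'a::cstar_algebra set \<Rightarrow> 'b::cstar_algebra set \<Rightarrow> bool" where
  "order_isomorphic S T \<longleftrightarrow>
     (\<exists>f. bij_betw f S T \<and> (\<forall>x\<in>S. \<forall>y\<in>S. cstar_le x y \<longleftrightarrow> cstar_le (f x) (f y)))"

definition jordan_star_iso :: "('a::cstar_algebra \<Rightarrow> 'b::cstar_algebra) \<Rightarrow> bool" where
  "jordan_star_iso J \<longleftrightarrow> bij J
     \<and> (\<forall>x y. J (x + y) = J x + J y)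
     \<and> (\<forall>c x. J (scaleC c x) = scaleC c (J x))
     \<and> (\<forall>a. J (cstar a) = cstar (J a))
     \<and> (\<forall>a b. J (a * b + b * a) = J a * J b + J b * J a)"

definition jordan_star_isomorphic :: "'a::cstar_algebra itself \<Rightarrow> 'b::cstar_algebra itself \<Rightarrow> bool" where
  "jordan_star_isomorphic _ _ \<longleftrightarrow> (\<exists>J :: 'a \<Rightarrow> 'b. jordan_star_iso J)"

definition commutative_alg :: "'a::cstar_algebra itself \<Rightarrow> bool" where
  "commutative_alg _ \<longleftrightarrow> (\<forall>a b :: 'a. a * b = b * a)"

definition is_projection :: "'a::cstar_algebra \<Rightarrow> bool" where
  "is_projection p \<longleftrightarrow> p * p = p \<and> cstar p = p"

definition AW_star :: "'a::cstar_algebra itself \<Rightarrow> bool" where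
  "AW_star _ \<longleftrightarrow> (\<forall>F :: 'a set. F \<noteq> {} \<longrightarrow>
      (\<exists>p. is_projection p \<and> {a. \<forall>b\<in>F. b * a = 0} = {p * x | x. True}))"

end

theory Submission
  imports Defs
begin

text \<open>Let \<open>f\<close> be an order isomorphism from the self-adjoint part of \<open>\<A>\<close> onto the positive invertible part
  of \<open>\<B>\<close>. Given \<open>x \<le> x'\<close> and \<open>l \<le> x'\<close> in \<open>\<A>\<close>, the fourth vertex \<open>l' = l - (x' - x)\<close> of the parallelogram
  satisfies \<open>l' \<le> x\<close>, and \<open>l - l'\<close> has the same support as \<open>x' - x\<close>. Comparison of supports can be phrased by
  the order alone, so such an \<open>l'\<close> also exists in \<open>\<B>\<close>. There, take a projection \<open>q\<close>, an element
  \<open>b = q b (1 - q)\<close> of small norm, \<open>x' = 2\<close>, \<open>x = \<epsilon> q + 2 (1 - q)\<close> and \<open>l = 1 + b + b\<^sup>*\<close>.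
  Then \<open>l - l'\<close> lies in \<open>q\<B>q\<close>, so \<open>l'\<close> has the corner \<open>q l' (1 - q) = b\<close>, while \<open>0 \<le> l' \<le> x\<close> bounds the norm
  of this corner by \<open>\<surd>(2\<epsilon>)\<close>. Hence \<open>b = 0\<close>, all projections of \<open>\<B>\<close> are central, and \<open>\<B>\<close> is commutative,
  since projections span a dense subspace of an \<open>AW\<^sup>*\<close>-algebra.

  Thus the positive invertible part of \<open>\<B>\<close> is closed under infima of pairs, so the self-adjoint part of \<open>\<A>\<close> has them too,
  and this makes the projections of \<open>\<A>\<close> commute. For commutative algebras \<open>f - f 0\<close> preserves
  orthogonality of positive elements, which gives a Boolean isomorphism of the projections; it extends
  isometrically to the whole algebra.\<close>

section \<open>The involution\<close>

lemma cstar_zero [simp]: "cstar (0::'a::cstar_algebra) = 0"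
  using cstar_add[of "0::'a" 0] by simp

lemma cstar_minus: "cstar (- x) = - cstar (x::'a::cstar_algebra)"
  using cstar_add[of x "- x"] by (simp add: eq_neg_iff_add_eq_0 add.commute)

lemma cstar_diff: "cstar (x - y) = cstar x - cstar (y::'a::cstar_algebra)"
  using cstar_add[of x "- y"] by (simp add: cstar_minus)

lemma cstar_one [simp]: "cstar (1::'a::cstar_algebra) = 1"
  using cstar_mult[of "cstar (1::'a)" 1] by (simp add: cstar_cstar)

lemma cstar_scaleR: "cstar (r *\<^sub>R x) = r *\<^sub>R cstar (x::'a::cstar_algebra)"
  by (simp add: scaleR_scaleC cstar_scaleC)

lemmas cstar_simps = cstar_add cstar_diff cstar_minus cstar_mult cstar_scaleR cstar_cstar

text \<open>The C*-identity bounds the square of \<open>norm y\<close> by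
  \<open>norm (cstar y) * norm y\<close>. Cancelling gives one inequality; the other is the same one
  for \<open>cstar x\<close>.\<close>

lemma norm_cstar [simp]: "norm (cstar x) = norm (x::'a::cstar_algebra)"
proof -
  have *: "norm y \<le> norm (cstar y)" for y :: 'a
  proof (cases "y = 0")
    case False
    have "norm y * norm y \<le> norm (cstar y) * norm y"
      using norm_mult_ineq[of "cstar y" y] by (simp add: cstar_identity power2_eq_square)
    then show ?thesis using False by simp
  qed simp
  show ?thesis using *[of x] *[of "cstar x"] by (simp add: cstar_cstar)
qed

lemma scaleC_minus_one: "scaleC (-1) x = - (x::'a::cstar_algebra)"
  using scaleR_scaleC[of "-1" x] by simp

lemma scaleC_diff_right: "scaleC c (x - y) = scaleC c x - scaleC c (y::'a::cstar_algebra)"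
  using scaleC_add_right[of c "x - y" y] by (simp add: eq_diff_eq)

lemma bounded_linear_cstar: "bounded_linear (cstar :: 'a::cstar_algebra \<Rightarrow> 'a)"
  by (rule bounded_linear_intro[of _ 1]) (simp_all add: cstar_add cstar_scaleR)

lemma norm_square_self_adjoint:
  "cstar h = h \<Longrightarrow> norm (h * h) = (norm (h::'a::cstar_algebra))\<^sup>2"
  using cstar_identity[of h] by simp

text \<open>For \<open>z = x + i y\<close> the commutation makes \<open>cstar z * z\<close> equal to
  the sum of squares, while \<open>x\<close> is the real part of \<open>z\<close> and so has norm at
  most \<open>norm z\<close>. This compares norms before any theory of positivity is
  available.\<close>

lemma norm_square_le_norm_sum_squares:
  fixes x y :: "'a::cstar_algebra"
  assumes "cstar x = x" "cstar y = y" "x * y = y * x"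
  shows "norm (x * x) \<le> norm (x * x + y * y)"
proof -
  define z where "z = x + scaleC \<i> y"
  have zs: "cstar z = x - scaleC \<i> y"
    using assms scaleC_add_left[of \<i> "-\<i>" y] scaleC_add_left[of 0 0 y]
    by (simp add: z_def cstar_add cstar_scaleC eq_neg_iff_add_eq_0 add.commute algebra_simps)
  have ii: "scaleC \<i> (scaleC \<i> u) = - u" for u :: 'a
    using scaleR_scaleC[of "-1" u] by (simp add: scaleC_scaleC)
  have "cstar z * z = x * x + y * y"
    unfolding zs by (simp add: z_def distrib_left left_diff_distrib mult_scaleC_left mult_scaleC_right
        ii assms scaleC_add_right scaleC_diff_right)
  then have nz: "norm (x * x + y * y) = (norm z)\<^sup>2"
    using cstar_identity[of z] by simp
  have "2 *\<^sub>R x = z + cstar z" unfolding zs by (simp add: z_def scaleR_2)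
  then have "2 * norm x \<le> norm z + norm (cstar z)"
    by (metis norm_scaleR norm_triangle_ineq abs_numeral)
  then have "norm x \<le> norm z" by simp
  then show ?thesis unfolding nz norm_square_self_adjoint[OF assms(1)] by (simp add: power_mono)
qed

section \<open>Square roots\<close>

text \<open>A fixed point \<open>y\<close> satisfies \<open>(1 - y) * (1 - y) = 1 - x\<close>; the
  iteration computes \<open>1 - sqrt (1 - x)\<close>.\<close>

fun sqrt_iter :: "'a::real_normed_algebra_1 \<Rightarrow> nat \<Rightarrow> 'a" where
  "sqrt_iter x 0 = 0"
| "sqrt_iter x (Suc n) = (1/2) *\<^sub>R (x + sqrt_iter x n * sqrt_iter x n)"

lemma sqrt_iter_commute:
  "y * x = x * y \<Longrightarrow> y * sqrt_iter x n = sqrt_iter x n * y"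
proof (induction n)
  case (Suc n)
  then have IH: "y * sqrt_iter x n = sqrt_iter x n * y" by simp
  have "y * (sqrt_iter x n * sqrt_iter x n) = (sqrt_iter x n * sqrt_iter x n) * y"
    by (metis IH mult.assoc)
  then show ?case using Suc.prems by (simp add: distrib_left distrib_right)
qed simp

lemma cstar_sqrt_iter: "cstar x = x \<Longrightarrow> cstar (sqrt_iter x n) = sqrt_iter x n"
  by (induction n) (simp_all add: cstar_simps)

lemma sqrt_iter_one: "0 \<le> sqrt_iter (1::real) n" "sqrt_iter (1::real) n \<le> 1"
proof -
  have "0 \<le> sqrt_iter (1::real) n \<and> sqrt_iter (1::real) n \<le> 1"
  proof (induction n)
    case (Suc n)
    then have "sqrt_iter 1 n * sqrt_iter 1 n \<le> (1::real)" by (simp add: mult_le_one)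
    then show ?case using Suc by simp
  qed simp
  then show "0 \<le> sqrt_iter (1::real) n" "sqrt_iter (1::real) n \<le> 1" by auto
qed

text \<open>The scalar iteration for 1 dominates the iteration for any contraction, which gives convergence
  up to and including norm 1.\<close>

lemma norm_sqrt_iter_le:
  "norm x \<le> 1 \<Longrightarrow> norm (sqrt_iter x n) \<le> sqrt_iter 1 n"
proof (induction n)
  case (Suc n)
  have "norm (sqrt_iter x n * sqrt_iter x n) \<le> sqrt_iter 1 n * sqrt_iter 1 n"
    by (rule order_trans[OF norm_mult_ineq mult_mono]) (use Suc sqrt_iter_one in auto)
  moreover have "norm (x + sqrt_iter x n * sqrt_iter x n) \<le> norm x + norm (sqrt_iter x n * sqrt_iter x n)"
    by (rule norm_triangle_ineq)
  ultimately show ?case using Suc.prems by simp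
qed simp

text \<open>Consecutive iterates commute, so each new increment is half the product of the previous
  increment and the sum of the two iterates. The scalar iteration factors in the same way, which
  carries the bound through the induction.\<close>

lemma norm_sqrt_iter_diff_le:
  "norm x \<le> 1 \<Longrightarrow>
    norm (sqrt_iter x (Suc n) - sqrt_iter x n) \<le> sqrt_iter 1 (Suc n) - sqrt_iter 1 n"
proof (induction n)
  case (Suc n)
  let ?a = "sqrt_iter x (Suc n)" and ?b = "sqrt_iter x n"
  let ?c = "sqrt_iter 1 (Suc n) :: real" and ?d = "sqrt_iter 1 n :: real"
  have com: "?a * ?b = ?b * ?a"
    by (intro sqrt_iter_commute sqrt_iter_commute[symmetric]) simp
  have "sqrt_iter x (Suc (Suc n)) - ?a = (1/2) *\<^sub>R ((x + ?a * ?a) - (x + ?b * ?b))"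
    by (metis sqrt_iter.simps(2) scaleR_diff_right)
  also have "(x + ?a * ?a) - (x + ?b * ?b) = (?a - ?b) * (?a + ?b)"
    using com by (simp add: algebra_simps del: sqrt_iter.simps)
  finally have eq: "sqrt_iter x (Suc (Suc n)) - ?a = (1/2) *\<^sub>R ((?a - ?b) * (?a + ?b))" .
  have "norm ((?a - ?b) * (?a + ?b)) \<le> (?c - ?d) * (?c + ?d)"
  proof (rule order_trans[OF norm_mult_ineq mult_mono])
    show "norm (?a - ?b) \<le> ?c - ?d" using Suc by blast
    show "norm (?a + ?b) \<le> ?c + ?d"
      by (rule order_trans[OF norm_triangle_ineq add_mono]) (use Suc norm_sqrt_iter_le in blast)+
    show "0 \<le> ?c - ?d" using Suc norm_ge_zero order_trans by blast
  qed simp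
  moreover have "sqrt_iter 1 (Suc (Suc n)) - ?c = (1/2) * ((?c - ?d) * (?c + ?d))"
    by (simp add: field_simps)
  ultimately show ?case unfolding eq by simp
qed simp

lemma convergent_sqrt_iter:
  fixes x :: "'a::{real_normed_algebra_1,banach}"
  assumes "norm x \<le> 1"
  shows "convergent (sqrt_iter x)"
proof -
  let ?c = "sqrt_iter (1::real)"
  \<comment> \<open>The scalar increments dominate norms, hence are nonnegative; boundedness by 1
    then makes them summable by telescoping.\<close>
  have "incseq ?c"
    by (rule incseq_SucI) (metis assms diff_ge_0_iff_ge norm_ge_zero norm_sqrt_iter_diff_le order_trans)
  then have "convergent ?c"
    using sqrt_iter_one(2) incseq_convergent unfolding convergent_def by metis
  then have "summable (\<lambda>n. ?c (Suc n) - ?c n)"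
    using telescope_summable unfolding convergent_def by blast
  then have "summable (\<lambda>n. sqrt_iter x (Suc n) - sqrt_iter x n)"
    by (rule summable_comparison_test'[where N = 0]) (use norm_sqrt_iter_diff_le[OF assms] in blast)
  then obtain s where "(\<lambda>n. sqrt_iter x (Suc n) - sqrt_iter x n) sums s"
    by (auto simp: summable_def)
  then have "(\<lambda>n. \<Sum>i<n. sqrt_iter x (Suc i) - sqrt_iter x i) \<longlonglongrightarrow> s"
    by (simp add: sums_def)
  then have "sqrt_iter x \<longlonglongrightarrow> s"
    by (subst (asm) sum_lessThan_telescope) simp
  then show ?thesis by (auto simp: convergent_def)
qed

text \<open>The bound on \<open>t *\<^sub>R 1 - a\<close> stands in for positivity of
  \<open>a\<close>: for \<open>t > 0\<close> it makes \<open>x = 1 - a / t\<close> a contraction,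
  and the limit \<open>y\<close> of the iteration yields the root \<open>sqrt t * (1 - y)\<close>.
  The last conclusion lets the root satisfy a bound of the same kind.\<close>

lemma sqrt_exists:
  fixes a :: "'a::cstar_algebra"
  assumes sa: "cstar a = a" and t: "norm (t *\<^sub>R 1 - a) \<le> t"
  obtains s where "cstar s = s" "s * s = a" "\<And>y. y * a = a * y \<Longrightarrow> y * s = s * y"
    "norm (sqrt t *\<^sub>R 1 - s) \<le> sqrt t"
proof (cases "t = 0")
  case True
  then have "a = 0" using t by simp
  then show ?thesis using that[of 0] True by simp
next
  case False
  then have tp: "t > 0" using t norm_ge_zero[of "t *\<^sub>R 1 - a"] by linarith
  define x where "x = 1 - (1/t) *\<^sub>R a"
  have "x = (1/t) *\<^sub>R (t *\<^sub>R 1 - a)" using tp by (simp add: x_def scaleR_diff_right)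
  then have "norm x = norm (t *\<^sub>R 1 - a) / t" using tp by (metis norm_scaleR abs_of_pos divide_inverse
        inverse_eq_divide mult.commute zero_less_divide_1_iff)
  then have "norm x \<le> 1" using t tp by simp
  then obtain y where y: "sqrt_iter x \<longlonglongrightarrow> y"
    using convergent_sqrt_iter[of x] by (auto simp: convergent_def)
  have xsa: "cstar x = x" using sa by (simp add: x_def cstar_simps)
  have "(\<lambda>n. sqrt_iter x (Suc n)) \<longlonglongrightarrow> (1/2) *\<^sub>R (x + y * y)"
    unfolding sqrt_iter.simps by (intro tendsto_intros y)
  then have fixp: "y = (1/2) *\<^sub>R (x + y * y)"
    using LIMSEQ_unique LIMSEQ_Suc[OF y] by blast
  have "(\<lambda>n. cstar (sqrt_iter x n)) \<longlonglongrightarrow> cstar y"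
    by (rule bounded_linear.tendsto[OF bounded_linear_cstar y])
  then have "sqrt_iter x \<longlonglongrightarrow> cstar y" by (simp only: cstar_sqrt_iter[OF xsa])
  then have ysa: "cstar y = y" by (rule LIMSEQ_unique[OF _ y])
  have "norm (sqrt_iter x n) \<le> 1" for n
    using norm_sqrt_iter_le[OF \<open>norm x \<le> 1\<close>] sqrt_iter_one(2) order_trans by blast
  then have "norm y \<le> 1" using LIMSEQ_le_const2[OF tendsto_norm[OF y]] by blast
  then have yn: "sqrt t * norm y \<le> sqrt t" using tp by simp
  have ycom: "z * y = y * z" if "z * a = a * z" for z
  proof -
    have "z * x = x * z" using that by (simp add: x_def algebra_simps)
    then have "(\<lambda>n. z * sqrt_iter x n) = (\<lambda>n. sqrt_iter x n * z)"
      using sqrt_iter_commute by blast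
    moreover have "(\<lambda>n. z * sqrt_iter x n) \<longlonglongrightarrow> z * y" by (intro tendsto_intros y)
    moreover have "(\<lambda>n. sqrt_iter x n * z) \<longlonglongrightarrow> y * z" by (intro tendsto_intros y)
    ultimately show ?thesis using LIMSEQ_unique by metis
  qed
  have "2 *\<^sub>R y = 2 *\<^sub>R ((1/2) *\<^sub>R (x + y * y))" using fixp by simp
  then have "y + y = x + y * y" by (simp add: scaleR_2)
  then have sq: "(1 - y) * (1 - y) = 1 - x" by (simp add: algebra_simps)
  show ?thesis
  proof (rule that[of "sqrt t *\<^sub>R (1 - y)"])
    show "cstar (sqrt t *\<^sub>R (1 - y)) = sqrt t *\<^sub>R (1 - y)" by (simp add: cstar_simps ysa)
    show "sqrt t *\<^sub>R (1 - y) * sqrt t *\<^sub>R (1 - y) = a"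
      using tp by (simp add: sq) (simp add: x_def)
    show "z * sqrt t *\<^sub>R (1 - y) = sqrt t *\<^sub>R (1 - y) * z" if "z * a = a * z" for z
      using ycom[OF that] by (simp add: algebra_simps)
    show "norm (sqrt t *\<^sub>R 1 - sqrt t *\<^sub>R (1 - y)) \<le> sqrt t"
      using yn tp by (simp flip: scaleR_diff_right)
  qed
qed

text \<open>A root \<open>r\<close> of \<open>t - h * h\<close> exists because
  \<open>t - (t - h * h)\<close> has norm at most \<open>t\<close>. It commutes with
  \<open>h\<close>, so the norm of \<open>r * r\<close> is at most that of
  \<open>r * r + h * h = t\<close>.\<close>

lemma norm_diff_square_le:
  fixes h :: "'a::cstar_algebra"
  assumes sa: "cstar h = h" and t: "norm (h * h) \<le> t"
  shows "norm (t *\<^sub>R 1 - h * h) \<le> t"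
proof -
  obtain r where r: "cstar r = r" "r * r = t *\<^sub>R 1 - h * h" "h * r = r * h"
    by (rule sqrt_exists[of "t *\<^sub>R 1 - h * h" t])
      (use sa t in \<open>auto simp: cstar_simps algebra_simps\<close>)
  have "norm (r * r) \<le> norm (r * r + h * h)"
    using r sa by (intro norm_square_le_norm_sum_squares) auto
  moreover have "0 \<le> t" using t norm_ge_zero order_trans by blast
  ultimately show ?thesis by (simp add: r(2))
qed

section \<open>Positive elements\<close>

lemma invertible_elI: "a * b = 1 \<Longrightarrow> b * a = 1 \<Longrightarrow> invertible_el a"
  by (auto simp: invertible_el_def)

lemma cstar_inverse:
  fixes a :: "'a::cstar_algebra"
  assumes "a * b = 1" "b * a = 1" "cstar a = a"
  shows "cstar b = b"
proof -
  have "cstar b * a = 1" using arg_cong[OF assms(1), of cstar] assms(3) by (simp add: cstar_mult)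
  then have "cstar b * a * b = b" by simp
  then show ?thesis using assms(1) by (simp add: mult.assoc)
qed

lemma invertible_el_scaleR:
  assumes "invertible_el a" "r \<noteq> 0"
  shows "invertible_el (r *\<^sub>R (a::'a::cstar_algebra))"
proof -
  obtain b where "a * b = 1" "b * a = 1" using assms by (auto simp: invertible_el_def)
  then show ?thesis using assms(2) by (intro invertible_elI[of _ "(1/r) *\<^sub>R b"]) auto
qed

lemma invertible_el_left_factor:
  fixes a b :: "'a::cstar_algebra"
  assumes "a * b = b * a" "invertible_el (a * b)"
  shows "invertible_el a"
proof -
  obtain c where c: "a * b * c = 1" "c * (a * b) = 1" using assms by (auto simp: invertible_el_def)
  have l: "(c * b) * a = 1" using c assms(1) by (simp add: mult.assoc)
  have r: "a * (b * c) = 1" using c by (simp add: mult.assoc)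
  have "c * b = b * c"
    by (metis l r mult.assoc mult.left_neutral mult.right_neutral)
  then show ?thesis using l r by (intro invertible_elI[of _ "b * c"]) simp_all
qed

lemma invertible_el_near_one:
  fixes a :: "'a::cstar_algebra"
  assumes "norm (1 - a) < 1"
  shows "invertible_el a"
proof -
  let ?x = "1 - a"
  have sm: "summable (\<lambda>n. ?x ^ n)" by (rule complete_algebra_summable_geometric[OF assms])
  define s where "s = (\<Sum>n. ?x ^ n)"
  have s: "(\<lambda>n. ?x ^ n) sums s" using sm s_def summable_sums by blast
  have 1: "(\<lambda>n. ?x * ?x ^ n) sums (s - 1)"
    using sums_split_initial_segment[OF s, of 1] by simp
  have 2: "(\<lambda>n. ?x * ?x ^ n) sums (?x * s)" by (rule sums_mult[OF s])
  have "(\<lambda>n. ?x ^ n * ?x) sums (s * ?x)" by (rule sums_mult2[OF s])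
  then have 3: "(\<lambda>n. ?x * ?x ^ n) sums (s * ?x)" by (simp only: power_commutes)
  have "?x * s = s - 1" "s * ?x = s - 1" using sums_unique2[OF 1 2] sums_unique2[OF 1 3] by auto
  then show ?thesis by (intro invertible_elI[of _ s]) (simp_all add: algebra_simps)
qed

text \<open>Division by \<open>t + e\<close> brings \<open>a + e\<close> within distance
  \<open>t / (t + e) < 1\<close> of the identity, where the Neumann series applies.\<close>

lemma invertible_el_add_scaleR:
  fixes a :: "'a::cstar_algebra"
  assumes "norm (t *\<^sub>R 1 - a) \<le> t" "0 < e"
  shows "invertible_el (a + e *\<^sub>R 1)"
proof -
  have t: "0 \<le> t" using assms(1) norm_ge_zero order_trans by blast
  let ?b = "(1/(t+e)) *\<^sub>R (a + e *\<^sub>R 1)"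
  have "1 - ?b = (1/(t+e)) *\<^sub>R ((t+e) *\<^sub>R 1 - (a + e *\<^sub>R 1))"
    using t assms(2) by (simp add: scaleR_diff_right)
  also have "\<dots> = (1/(t+e)) *\<^sub>R (t *\<^sub>R 1 - a)" by (simp add: algebra_simps)
  finally have "norm (1 - ?b) = norm (t *\<^sub>R 1 - a) / (t + e)" using t assms(2) by simp
  also have "\<dots> < 1" using t assms by (simp add: field_simps)
  finally have "invertible_el ?b" by (rule invertible_el_near_one)
  then have "invertible_el ((t+e) *\<^sub>R ?b)"
    by (rule invertible_el_scaleR) (use t assms(2) in linarith)
  moreover have "(t+e) *\<^sub>R ?b = a + e *\<^sub>R 1" unfolding scaleR_scaleR using t assms(2) by simp
  ultimately show ?thesis by metis
qed

section \<open>Positivity in terms of the norm\<close>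

text \<open>Both kinds of excluded spectral values reduce to invertibility of a square plus a
  positive scalar. A negative real \<open>z\<close> does so directly; for nonreal \<open>z\<close>,
  the element \<open>k * k + (Im z)^2\<close> is the product of the commuting factors
  \<open>k - w\<close> and \<open>k + w\<close> with \<open>w = i Im z\<close>.\<close>

lemma positive_el_square:
  fixes h :: "'a::cstar_algebra"
  assumes sa: "cstar h = h"
  shows "positive_el (h * h)"
proof -
  have "invertible_el (h * h - scaleC z 1)" if z: "\<not> (Im z = 0 \<and> Re z \<ge> 0)" for z
  proof (cases "Im z = 0")
    case True
    then have "z = complex_of_real (Re z)" by (simp add: complex_eq_iff)
    then have zz: "scaleC z (1::'a) = Re z *\<^sub>R 1" by (metis scaleR_scaleC)
    have "invertible_el (h * h + (- Re z) *\<^sub>R 1)"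
      using norm_diff_square_le[OF sa order_refl] True z by (intro invertible_el_add_scaleR) auto
    then show ?thesis by (simp add: zz)
  next
    case False
    define k where "k = h * h - Re z *\<^sub>R 1"
    have ksa: "cstar k = k" using sa by (simp add: k_def cstar_simps)
    define w where "w = scaleC (\<i> * complex_of_real (Im z)) (1::'a)"
    have zd: "scaleC z 1 = Re z *\<^sub>R (1::'a) + w"
      by (simp add: w_def scaleR_scaleC flip: scaleC_add_left complex_eq)
    have ww: "w * w = - ((Im z)\<^sup>2 *\<^sub>R 1)"
      using scaleR_scaleC[of "- ((Im z)\<^sup>2)" "1::'a"]
      by (simp add: w_def mult_scaleC_left mult_scaleC_right scaleC_scaleC power2_eq_square algebra_simps)
    have wk: "w * k = k * w" by (simp add: w_def mult_scaleC_left mult_scaleC_right)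
    have "invertible_el (k * k + (Im z)\<^sup>2 *\<^sub>R 1)"
      using norm_diff_square_le[OF ksa order_refl] False by (intro invertible_el_add_scaleR) auto
    then have "invertible_el ((k - w) * (k + w))" by (simp add: algebra_simps wk ww)
    then have "invertible_el (k - w)"
      by (rule invertible_el_left_factor[rotated]) (simp add: algebra_simps wk)
    then show ?thesis by (simp add: zd k_def algebra_simps)
  qed
  then show ?thesis unfolding positive_el_def cspectrum_def using sa by (auto simp: cstar_mult)
qed

lemma positive_elI_norm:
  fixes a :: "'a::cstar_algebra"
  assumes "cstar a = a" "norm (t *\<^sub>R 1 - a) \<le> t"
  shows "positive_el a"
  using sqrt_exists[OF assms] positive_el_square by metis

text \<open>A descent on shifts: \<open>S\<close> collects the \<open>s \<ge> 0\<close> for which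
  \<open>a + s\<close> is the square of a self-adjoint element. The norm bound for such squares
  survives passage to the infimum \<open>s0\<close>, and invertibility of \<open>a + s0\<close>
  would allow a further decrease if \<open>s0 > 0\<close>.\<close>

lemma norm_bound_if_shifts_invertible:
  fixes a :: "'a::cstar_algebra"
  assumes sa: "cstar a = a" and inv: "\<And>e. 0 < e \<Longrightarrow> invertible_el (a + e *\<^sub>R 1)"
  shows "\<exists>t. norm (t *\<^sub>R 1 - a) \<le> t"
proof -
  let ?P = "\<lambda>b::'a. \<exists>h. cstar h = h \<and> b = h * h"
  define S where "S = {s. 0 \<le> s \<and> ?P (a + s *\<^sub>R 1)}"
  have sa': "cstar (a + s *\<^sub>R 1) = a + s *\<^sub>R 1" for s using sa by (simp add: cstar_simps)
  have "norm (norm a *\<^sub>R 1 - (a + norm a *\<^sub>R 1)) \<le> norm a" by simp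
  then have "norm a \<in> S" using sqrt_exists[OF sa'] unfolding S_def by (smt (verit) mem_Collect_eq norm_ge_zero)
  then have ne: "S \<noteq> {}" by auto
  have bdd: "bdd_below S" by (rule bdd_belowI[of _ 0]) (simp add: S_def)
  define s0 where "s0 = Inf S"
  have s0: "0 \<le> s0" unfolding s0_def by (rule cInf_greatest[OF ne]) (simp add: S_def)
  \<comment> \<open>One bound for the norms of all squares \<open>a + s\<close> with
    \<open>s < s0 + 1\<close>, so that \<open>s\<close> can tend to \<open>s0\<close> with
    \<open>t\<close> fixed.\<close>
  define t where "t = norm a + s0 + 1"
  have near: "\<exists>s\<in>S. s < s0 + e" if "e > 0" for e
    using cInf_lessD[OF ne, of "s0 + e"] that by (auto simp: s0_def)
  have closed: "norm (t *\<^sub>R 1 - (a + s0 *\<^sub>R 1)) \<le> t"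
  proof (rule field_le_epsilon)
    fix e :: real assume e: "e > 0"
    obtain s where s: "s \<in> S" "s < s0 + min e 1" using near[of "min e 1"] e by auto
    have ss: "s0 \<le> s" unfolding s0_def by (rule cInf_lower[OF s(1) bdd])
    obtain h where h: "cstar h = h" "a + s *\<^sub>R 1 = h * h" using s by (auto simp: S_def)
    have "norm (a + s *\<^sub>R 1) \<le> norm a + norm (s *\<^sub>R (1::'a))" by (rule norm_triangle_ineq)
    then have "norm (h * h) \<le> t" using s ss s0 h by (simp add: t_def)
    then have "norm (t *\<^sub>R 1 - (a + s *\<^sub>R 1)) \<le> t" using norm_diff_square_le h by metis
    moreover have "norm (t *\<^sub>R 1 - (a + s0 *\<^sub>R 1)) \<le> norm (t *\<^sub>R 1 - (a + s *\<^sub>R 1)) + norm ((s - s0) *\<^sub>R (1::'a))"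
      by (rule order_trans[OF _ norm_triangle_ineq]) (simp add: algebra_simps)
    ultimately show "norm (t *\<^sub>R 1 - (a + s0 *\<^sub>R 1)) \<le> t + e" using ss s by simp
  qed
  have "s0 = 0"
  proof (rule ccontr)
    assume "s0 \<noteq> 0"
    then have s0p: "s0 > 0" using s0 by simp
    obtain h where h: "cstar h = h" "h * h = a + s0 *\<^sub>R 1" using sqrt_exists[OF sa' closed] by metis
    have "invertible_el (h * h)" unfolding h(2) by (rule inv[OF s0p])
    then have "invertible_el h" by (rule invertible_el_left_factor[rotated]) simp
    then obtain g where g: "h * g = 1" "g * h = 1" by (auto simp: invertible_el_def)
    have gsa: "cstar g = g" using cstar_inverse[OF g h(1)] .
    have gn: "norm (g * g) > 0"
    proof -
      have "h * (g * g) * h = 1" using g by (metis mult.assoc mult.left_neutral)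
      then show ?thesis by force
    qed
    \<comment> \<open>With \<open>g\<close> the inverse of \<open>h\<close>,
      \<open>h * h - d\<close> is \<open>h * (1 - d g g) * h\<close>. The bound
      \<open>d * norm (g * g) \<le> 1\<close> provides a root of the middle factor, and
      \<open>d \<le> s0\<close> keeps the new shift nonnegative.\<close>
    define d where "d = min s0 (1 / norm (g * g))"
    have d: "d > 0" "d \<le> s0" "d * norm (g * g) \<le> 1"
      using s0p gn by (auto simp: d_def min_def field_simps)
    have n1: "norm (1 *\<^sub>R 1 - (1 - d *\<^sub>R (g * g))) \<le> 1" using d by simp
    have sa1: "cstar (1 - d *\<^sub>R (g * g)) = 1 - d *\<^sub>R (g * g)" by (simp add: cstar_simps gsa)
    obtain r where r: "cstar r = r" "r * r = 1 - d *\<^sub>R (g * g)"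
        and rc: "\<And>y. y * (1 - d *\<^sub>R (g * g)) = (1 - d *\<^sub>R (g * g)) * y \<Longrightarrow> y * r = r * y"
      by (rule sqrt_exists[OF sa1 n1]) blast
    have hgg: "h * (g * g) = g" "g * g * h = g" using g by (simp_all add: mult.assoc) (simp flip: mult.assoc add: g)
    have hr: "h * r = r * h" by (rule rc) (simp add: algebra_simps hgg[unfolded mult.assoc] hgg(1))
    have "(h * r) * (h * r) = h * (r * r) * h" by (simp add: mult.assoc flip: hr)
    also have "\<dots> = h * h - d *\<^sub>R 1"
      unfolding r by (simp add: algebra_simps g hgg[unfolded mult.assoc])
    also have "\<dots> = a + (s0 - d) *\<^sub>R 1" unfolding h(2) by (simp add: algebra_simps)
    finally have eq: "a + (s0 - d) *\<^sub>R 1 = (h * r) * (h * r)" by simp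
    moreover have "cstar (h * r) = h * r" using h r hr by (simp add: cstar_mult)
    ultimately have "s0 - d \<in> S" using d unfolding S_def by auto
    then have "s0 \<le> s0 - d" unfolding s0_def by (rule cInf_lower[OF _ bdd])
    then show False using d by simp
  qed
  then show ?thesis using closed by auto
qed

text \<open>Replaces the spectral definition by a norm bound, the form in which sums and roots can
  be handled. Only invertibility of \<open>a + e\<close> for \<open>e > 0\<close> is extracted from
  the spectrum.\<close>

lemma positive_el_iff_norm:
  fixes a :: "'a::cstar_algebra"
  shows "positive_el a \<longleftrightarrow> cstar a = a \<and> (\<exists>t. norm (t *\<^sub>R 1 - a) \<le> t)"
proof (intro iffI conjI)
  assume p: "positive_el a"
  then show sa: "cstar a = a" by (simp add: positive_el_def)
  have "invertible_el (a + e *\<^sub>R 1)" if "e > 0" for e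
  proof -
    have "complex_of_real (- e) \<notin> cspectrum a" using p that by (auto simp: positive_el_def)
    then have "invertible_el (a - (- e) *\<^sub>R 1)" by (simp only: scaleR_scaleC) (simp add: cspectrum_def)
    then show ?thesis by simp
  qed
  then show "\<exists>t. norm (t *\<^sub>R 1 - a) \<le> t" using norm_bound_if_shifts_invertible[OF sa] by blast
next
  assume "cstar a = a \<and> (\<exists>t. norm (t *\<^sub>R 1 - a) \<le> t)"
  then show "positive_el a" by (auto intro: positive_elI_norm)
qed

lemma positive_elI_invertible:
  fixes a :: "'a::cstar_algebra"
  assumes "cstar a = a" "\<And>e. 0 < e \<Longrightarrow> invertible_el (a + e *\<^sub>R 1)"
  shows "positive_el a"
  using norm_bound_if_shifts_invertible[OF assms] assms(1) by (simp add: positive_el_iff_norm)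

lemma positive_el_self_adjoint: "positive_el a \<Longrightarrow> cstar a = a"
  by (simp add: positive_el_def)

lemma positive_el_norm_bound:
  assumes "positive_el (a::'a::cstar_algebra)"
  obtains t where "norm (t *\<^sub>R 1 - a) \<le> t"
  using assms positive_el_iff_norm[of a] by auto

lemma positive_el_sqrt:
  fixes a :: "'a::cstar_algebra"
  assumes "positive_el a"
  obtains s where "cstar s = s" "s * s = a" "\<And>y. y * a = a * y \<Longrightarrow> y * s = s * y"
    "positive_el s"
proof -
  obtain t where t: "norm (t *\<^sub>R 1 - a) \<le> t" using assms by (rule positive_el_norm_bound)
  obtain s where "cstar s = s" "s * s = a" "\<And>y. y * a = a * y \<Longrightarrow> y * s = s * y"
    "norm (sqrt t *\<^sub>R 1 - s) \<le> sqrt t"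
    by (rule sqrt_exists[OF positive_el_self_adjoint[OF assms] t]) blast
  then show ?thesis using that positive_elI_norm by blast
qed

text \<open>The norm bounds of the two summands add up by the triangle inequality.\<close>

lemma positive_el_add:
  fixes a b :: "'a::cstar_algebra"
  assumes "positive_el a" "positive_el b"
  shows "positive_el (a + b)"
proof -
  obtain s where s: "norm (s *\<^sub>R 1 - a) \<le> s" using assms(1) by (rule positive_el_norm_bound)
  obtain t where t: "norm (t *\<^sub>R 1 - b) \<le> t" using assms(2) by (rule positive_el_norm_bound)
  have "(s + t) *\<^sub>R 1 - (a + b) = (s *\<^sub>R 1 - a) + (t *\<^sub>R 1 - b)" by (simp add: algebra_simps)
  have "norm ((s + t) *\<^sub>R 1 - (a + b)) \<le> s + t"
    unfolding \<open>(s + t) *\<^sub>R 1 - (a + b) = _\<close>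
    using norm_triangle_ineq[of "s *\<^sub>R 1 - a" "t *\<^sub>R 1 - b"] s t by linarith
  then show ?thesis
    using assms by (intro positive_elI_norm) (auto simp: cstar_add positive_el_self_adjoint)
qed

lemma positive_el_mult:
  fixes a b :: "'a::cstar_algebra"
  assumes "positive_el a" "positive_el b" and com: "a * b = b * a"
  shows "positive_el (a * b)"
proof -
  obtain s where s: "cstar s = s" "s * s = a" "\<And>y. y * a = a * y \<Longrightarrow> y * s = s * y"
    by (rule positive_el_sqrt[OF assms(1)]) blast
  obtain r where r: "cstar r = r" "r * r = b" "\<And>y. y * b = b * y \<Longrightarrow> y * r = r * y"
    by (rule positive_el_sqrt[OF assms(2)]) blast
  have rs: "s * r = r * s" using r(3) s(3) com by metis
  have "(s * r) * (s * r) = s * (r * s) * r" by (simp only: mult.assoc)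
  also have "\<dots> = a * b" by (simp add: mult.assoc flip: rs s(2) r(2))
  finally have "a * b = (s * r) * (s * r)" by simp
  moreover have "cstar (s * r) = s * r" using s(1) r(1) rs by (simp add: cstar_mult)
  ultimately show ?thesis using positive_el_square[of "s * r"] by simp
qed

lemma positive_el_zero [simp]: "positive_el (0::'a::cstar_algebra)"
  using positive_el_square[of "0::'a"] by simp

lemma positive_el_one [simp]: "positive_el (1::'a::cstar_algebra)"
  using positive_el_square[of "1::'a"] by simp

lemma positive_el_scaleR:
  fixes a :: "'a::cstar_algebra"
  assumes "positive_el a" "0 \<le> r"
  shows "positive_el (r *\<^sub>R a)"
proof -
  obtain s where s: "cstar s = s" "s * s = a" by (rule positive_el_sqrt[OF assms(1)]) blast
  have "r *\<^sub>R a = (sqrt r *\<^sub>R s) * (sqrt r *\<^sub>R s)" using s assms(2) by simp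
  moreover have "cstar (sqrt r *\<^sub>R s) = sqrt r *\<^sub>R s" using s by (simp add: cstar_scaleR)
  ultimately show ?thesis using positive_el_square by metis
qed

lemma positive_el_scaleR_iff:
  "0 < r \<Longrightarrow> positive_el (r *\<^sub>R (a::'a::cstar_algebra)) \<longleftrightarrow> positive_el a"
  using positive_el_scaleR[of "r *\<^sub>R a" "1/r"] positive_el_scaleR[of a r] by auto

lemma positive_el_trans:
  fixes a b c :: "'a::cstar_algebra"
  assumes "positive_el (b - a)" "positive_el (c - b)"
  shows "positive_el (c - a)"
  using positive_el_add[OF assms] by simp

lemma positive_el_ge_positive:
  fixes a b :: "'a::cstar_algebra"
  assumes "positive_el a" "positive_el (b - a)"
  shows "positive_el b"
  using positive_el_add[OF assms] by simp

lemma positive_el_norm_diff: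
  fixes a :: "'a::cstar_algebra"
  assumes "cstar a = a" "norm a \<le> t"
  shows "positive_el (t *\<^sub>R 1 - a)"
  using assms by (intro positive_elI_norm[of _ t]) (auto simp: cstar_simps)

text \<open>Commuting square roots of \<open>a\<close> and \<open>t - a\<close> have squares summing
  to \<open>t\<close>, so \<open>norm_square_le_norm_sum_squares\<close> applies.\<close>

lemma norm_le_scaleR_one:
  fixes a :: "'a::cstar_algebra"
  assumes "positive_el a" "positive_el (t *\<^sub>R 1 - a)" "0 \<le> t"
  shows "norm a \<le> t"
proof -
  obtain s where s: "cstar s = s" "s * s = a" "\<And>y. y * a = a * y \<Longrightarrow> y * s = s * y"
    by (rule positive_el_sqrt[OF assms(1)]) blast
  obtain r where r: "cstar r = r" "r * r = t *\<^sub>R 1 - a"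
      "\<And>y. y * (t *\<^sub>R 1 - a) = (t *\<^sub>R 1 - a) * y \<Longrightarrow> y * r = r * y"
    by (rule positive_el_sqrt[OF assms(2)]) blast
  have sa: "s * a = a * s" using s(2) by (metis mult.assoc)
  have "s * r = r * s" by (rule r(3)) (simp add: algebra_simps sa)
  then show ?thesis
    using norm_square_le_norm_sum_squares[OF s(1) r(1)] s(2) r(2) assms(3) by simp
qed

lemma norm_mono_positive:
  fixes a b :: "'a::cstar_algebra"
  assumes "positive_el a" "positive_el (b - a)"
  shows "norm a \<le> norm b"
proof (rule norm_le_scaleR_one[OF assms(1)])
  have "positive_el (norm b *\<^sub>R 1 - b)"
    using positive_el_ge_positive[OF assms] by (intro positive_el_norm_diff) (auto simp: positive_el_self_adjoint)
  then show "positive_el (norm b *\<^sub>R 1 - a)" using positive_el_trans[OF assms(2)] by blast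
qed simp

lemma positive_el_antisym:
  fixes a :: "'a::cstar_algebra"
  assumes "positive_el a" "positive_el (- a)"
  shows "a = 0"
  using norm_mono_positive[of a 0] assms by simp

text \<open>The factors \<open>t - h\<close> and \<open>t + h\<close> commute, so their product
  \<open>t * t - h * h\<close> is positive, which bounds the norm of \<open>h * h\<close>.\<close>

lemma norm_le_two_sided:
  fixes h :: "'a::cstar_algebra"
  assumes "positive_el (t *\<^sub>R 1 - h)" "positive_el (t *\<^sub>R 1 + h)" "0 \<le> t" "cstar h = h"
  shows "norm h \<le> t"
proof -
  have "positive_el ((t *\<^sub>R 1 - h) * (t *\<^sub>R 1 + h))"
    using assms by (intro positive_el_mult) (auto simp: algebra_simps)
  then have "positive_el ((t * t) *\<^sub>R 1 - h * h)" by (simp add: algebra_simps)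
  then have "norm (h * h) \<le> t * t"
    using assms by (intro norm_le_scaleR_one positive_el_square) auto
  then show ?thesis using assms by (simp add: norm_square_self_adjoint power2_eq_square abs_le_square_iff[symmetric])
      (metis abs_le_square_iff abs_of_nonneg norm_ge_zero power2_eq_square)
qed

text \<open>Here \<open>s\<close> is the absolute value of \<open>h\<close>, and \<open>p\<close>,
  \<open>n\<close> are half of \<open>s + h\<close> and \<open>s - h\<close>. Since
  \<open>p * n = 0\<close>, the product of \<open>p + e\<close> and \<open>n + e\<close> is
  \<open>e * (s + e)\<close>, which is invertible; so are its commuting factors, which gives
  positivity.\<close>

lemma positive_negative_parts:
  fixes h :: "'a::cstar_algebra"
  assumes sa: "cstar h = h"
  obtains p n where "h = p - n" "positive_el p" "positive_el n" "p * n = 0" "n * p = 0"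
    "norm p \<le> norm h" "norm n \<le> norm h"
proof -
  obtain s where s: "cstar s = s" "s * s = h * h" "\<And>y. y * (h * h) = h * h * y \<Longrightarrow> y * s = s * y"
      "positive_el s"
    by (rule positive_el_sqrt[OF positive_el_square[OF sa]]) blast
  have hs: "h * s = s * h" by (rule s(3)) (simp add: mult.assoc)
  define p n where "p = (1/2) *\<^sub>R (s + h)" and "n = (1/2) *\<^sub>R (s - h)"
  have sa': "cstar p = p" "cstar n = n" using s(1) sa by (simp_all add: p_def n_def cstar_simps)
  have pn: "p * n = 0" "n * p = 0" using hs s(2) by (simp_all add: p_def n_def algebra_simps)
  have pns: "p + n = s" by (simp add: p_def n_def flip: scaleR_add_right)
  have inv: "invertible_el ((p + e *\<^sub>R 1) * (n + e *\<^sub>R 1))" if "e > 0" for e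
  proof -
    have "(p + e *\<^sub>R 1) * (n + e *\<^sub>R 1) = e *\<^sub>R (s + e *\<^sub>R 1)"
      unfolding pns[symmetric] using pn by (simp add: algebra_simps)
    moreover have "invertible_el (s + e *\<^sub>R 1)"
      by (rule positive_el_norm_bound[OF s(4)]) (rule invertible_el_add_scaleR[OF _ that])
    ultimately show ?thesis using that by (simp add: invertible_el_scaleR)
  qed
  have com: "(p + e *\<^sub>R 1) * (n + e *\<^sub>R 1) = (n + e *\<^sub>R 1) * (p + e *\<^sub>R 1)" for e
    using pn by (simp add: algebra_simps)
  have "invertible_el (p + e *\<^sub>R 1)" "invertible_el (n + e *\<^sub>R 1)" if "e > 0" for e
    using invertible_el_left_factor[OF com inv[OF that]]
      invertible_el_left_factor[OF com[symmetric] inv[OF that, unfolded com]] by auto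
  then have pos: "positive_el p" "positive_el n"
    using sa' by (auto intro!: positive_elI_invertible)
  have "(norm s)\<^sup>2 = (norm h)\<^sup>2" using s(1,2) sa norm_square_self_adjoint by metis
  then have ns: "norm s = norm h" by simp
  show ?thesis
  proof (rule that[OF _ pos pn])
    show "h = p - n" by (simp add: p_def n_def flip: scaleR_diff_right)
    show "norm p \<le> norm h" using norm_mono_positive[of p s] pos pns ns by force
    show "norm n \<le> norm h" using norm_mono_positive[of n s] pos pns ns by force
  qed
qed

text \<open>If \<open>b\<close> is the inverse of \<open>a\<close>, then \<open>1 - e * b\<close> is
  positive for small \<open>e\<close>, and multiplying it by the commuting \<open>a\<close> leaves
  \<open>a - e\<close>.\<close>

lemma positive_invertible_part_iff:
  "a \<in> positive_invertible_part \<longleftrightarrow> (\<exists>e>0. positive_el (a - e *\<^sub>R (1::'a::cstar_algebra)))"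
proof
  assume "a \<in> positive_invertible_part"
  then have a: "positive_el a" "invertible_el a" by (auto simp: positive_invertible_part_def)
  then obtain b where b: "a * b = 1" "b * a = 1" by (auto simp: invertible_el_def)
  have bsa: "cstar b = b" using cstar_inverse[OF b] positive_el_self_adjoint[OF a(1)] .
  define e where "e = 1 / (norm b + 1)"
  have e: "e > 0" "e * norm b \<le> 1" by (auto simp: e_def field_simps add_pos_nonneg)
  have "positive_el (1 *\<^sub>R 1 - e *\<^sub>R b)"
    using e bsa by (intro positive_el_norm_diff) (auto simp: cstar_simps)
  then have "positive_el (a * (1 - e *\<^sub>R b))"
    using a(1) b by (intro positive_el_mult) (auto simp: algebra_simps)
  then show "\<exists>e>0. positive_el (a - e *\<^sub>R 1)" using e(1) b by (auto simp: algebra_simps)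
next
  assume "\<exists>e>0. positive_el (a - e *\<^sub>R 1)"
  then obtain e where e: "e > 0" "positive_el (a - e *\<^sub>R 1)" by auto
  have "positive_el (e *\<^sub>R (1::'a))" using e by (simp add: positive_el_scaleR)
  then have "positive_el a" using positive_el_ge_positive e by blast
  moreover obtain t where "norm (t *\<^sub>R 1 - (a - e *\<^sub>R 1)) \<le> t"
    using e(2) by (rule positive_el_norm_bound)
  then have "invertible_el a" using invertible_el_add_scaleR[of t "a - e *\<^sub>R 1" e] e(1) by simp
  ultimately show "a \<in> positive_invertible_part" by (simp add: positive_invertible_part_def)
qed

lemma positive_invertible_part_upward:
  fixes a b :: "'a::cstar_algebra"
  assumes "a \<in> positive_invertible_part" "positive_el (b - a)"
  shows "b \<in> positive_invertible_part"
proof -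
  obtain e where "e > 0" "positive_el (a - e *\<^sub>R 1)"
    using assms(1) positive_invertible_part_iff by blast
  then have "positive_el (b - e *\<^sub>R 1)" using positive_el_trans assms(2) by blast
  then show ?thesis using \<open>e > 0\<close> positive_invertible_part_iff by blast
qed

section \<open>Projections\<close>

lemma is_projection_one [simp]: "is_projection (1::'a::cstar_algebra)"
  by (simp add: is_projection_def)

lemma is_projection_zero [simp]: "is_projection (0::'a::cstar_algebra)"
  by (simp add: is_projection_def)

lemma is_projection_complement: "is_projection p \<Longrightarrow> is_projection (1 - p)"
  by (simp add: is_projection_def cstar_simps algebra_simps)

lemma positive_el_projection: "is_projection p \<Longrightarrow> positive_el p"
  using positive_el_square[of p] by (simp add: is_projection_def)

lemma norm_projection_le: "is_projection p \<Longrightarrow> norm p \<le> 1"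
  using norm_le_scaleR_one[of p 1] positive_el_projection is_projection_complement by fastforce

lemma norm_projection_nonzero:
  assumes "is_projection p" "p \<noteq> 0"
  shows "norm p = 1"
proof -
  have "norm p * norm p = norm p * 1"
    using norm_square_self_adjoint[of p] assms(1) by (simp add: is_projection_def power2_eq_square)
  then show ?thesis using assms(2) by (metis mult_left_cancel norm_eq_zero)
qed

text \<open>Averaging over the symmetry \<open>2q - 1\<close> yields a positive element commuting with \<open>q\<close>.\<close>

lemma positive_el_compress:
  fixes a q :: "'a::cstar_algebra"
  assumes a: "positive_el a" and q: "is_projection q"
  shows "positive_el (q * a * q)"
proof -
  have qq: "q * q = q" "cstar q = q" using q by (auto simp: is_projection_def)
  have qq': "q * (q * y) = q * y" for y by (simp add: qq flip: mult.assoc)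
  define u where "u = q + q - 1"
  have uu: "u * u = 1" "cstar u = u" by (simp_all add: u_def qq cstar_simps algebra_simps)
  obtain s where s: "cstar s = s" "s * s = a" by (rule positive_el_sqrt[OF a]) blast
  have "u * a * u = (u * s * u) * (u * s * u)"
    using s(2) uu(1) by (metis mult.assoc mult.left_neutral)
  moreover have "cstar (u * s * u) = u * s * u" using s uu by (simp add: cstar_mult mult.assoc)
  ultimately have "positive_el (u * a * u)" using positive_el_square by metis
  then have b: "positive_el (a + u * a * u)" using a positive_el_add by blast
  have qb: "q * (a + u * a * u) = 2 *\<^sub>R (q * a * q)" "(a + u * a * u) * q = 2 *\<^sub>R (q * a * q)"
    by (simp_all add: u_def algebra_simps qq qq' scaleR_2)
  then have "positive_el (q * (a + u * a * u))"
    using b positive_el_projection[OF q] by (intro positive_el_mult) auto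
  then show ?thesis unfolding qb by (simp add: positive_el_scaleR_iff)
qed

lemma norm_sqrt_mult_projection:
  fixes s q :: "'a::cstar_algebra"
  assumes "cstar s = s" "is_projection q"
  shows "(norm (s * q))\<^sup>2 = norm (q * (s * s) * q)" "(norm (q * s))\<^sup>2 = norm (q * (s * s) * q)"
proof -
  have q: "cstar q = q" using assms by (simp add: is_projection_def)
  show *: "(norm (s * q))\<^sup>2 = norm (q * (s * s) * q)"
    using cstar_identity[of "s * q"] assms(1) q by (simp add: cstar_mult mult.assoc)
  have "norm (q * s) = norm (s * q)" using norm_cstar[of "q * s"] assms(1) q by (simp add: cstar_mult)
  then show "(norm (q * s))\<^sup>2 = norm (q * (s * s) * q)" using * by simp
qed

text \<open>For a root \<open>s\<close> of \<open>a\<close> the square of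
  \<open>norm (s * q)\<close> is \<open>norm (q * a * q)\<close>, so already \<open>s * q\<close>
  vanishes.\<close>

lemma positive_el_compress_zero:
  fixes a q :: "'a::cstar_algebra"
  assumes "positive_el a" "is_projection q" "q * a * q = 0"
  shows "a * q = 0" "q * a = 0"
proof -
  obtain s where s: "cstar s = s" "s * s = a" by (rule positive_el_sqrt[OF assms(1)]) blast
  have "s * q = 0" "q * s = 0"
    using norm_sqrt_mult_projection[OF s(1) assms(2)] s(2) assms(3) by simp_all
  then show "a * q = 0" "q * a = 0" using s(2) by (metis mult.assoc mult_zero_right mult_zero_left)+
qed

text \<open>Compression squeezes the corner of \<open>a\<close> between zero and that of
  \<open>b\<close>. The typical use takes for \<open>b\<close> a multiple of a projection
  \<open>p\<close> and for \<open>q\<close> its complement, giving \<open>p * a = a\<close>.\<close>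

lemma positive_el_below_compress_zero:
  fixes a b q :: "'a::cstar_algebra"
  assumes "positive_el a" "positive_el (b - a)" "is_projection q" "q * b * q = 0"
  shows "a * q = 0" "q * a = 0"
proof -
  have "positive_el (q * (b - a) * q)" using assms by (intro positive_el_compress)
  then have "positive_el (- (q * a * q))" using assms(4) by (simp add: algebra_simps)
  then have "q * a * q = 0" using positive_el_antisym positive_el_compress assms by blast
  then show "a * q = 0" "q * a = 0" using positive_el_compress_zero assms by blast+
qed

section \<open>Annihilator projections and density of their span\<close>

lemma AW_star_annihilator:
  fixes F :: "'a::cstar_algebra set"
  assumes "AW_star TYPE('a)" "F \<noteq> {}"
  obtains p where "is_projection p" "\<And>a. (\<forall>b\<in>F. b * a = 0) \<longleftrightarrow> p * a = a"
proof -
  obtain p where p: "is_projection p" "{a. \<forall>b\<in>F. b * a = 0} = {p * x | x. True}"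
    using assms(1)[unfolded AW_star_def, rule_format, OF assms(2)] by blast
  have "(\<forall>b\<in>F. b * a = 0) \<longleftrightarrow> p * a = a" for a
  proof -
    have "(\<forall>b\<in>F. b * a = 0) \<longleftrightarrow> a \<in> {p * x | x. True}" unfolding p(2)[symmetric] by simp
    also have "\<dots> \<longleftrightarrow> (\<exists>x. a = p * x)" by simp
    also have "\<dots> \<longleftrightarrow> p * a = a"
    proof
      assume "\<exists>x. a = p * x"
      then obtain x where "a = p * x" ..
      then show "p * a = a" using p(1) by (simp add: is_projection_def flip: mult.assoc)
    next
      assume "p * a = a"
      then show "\<exists>x. a = p * x" by (intro exI[of _ a]) simp
    qed
    finally show ?thesis .
  qed
  then show ?thesis using that p(1) by blast
qed

text \<open>Let \<open>p\<close> and \<open>n\<close> be the positive and negative parts of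
  \<open>c - M/2\<close>. The complement \<open>e\<close> of the annihilator projection
  \<open>E\<close> of \<open>p\<close> acts as the spectral projection of \<open>c\<close> above
  \<open>M/2\<close>: the remainder is \<open>p\<close> on \<open>e\<close> and
  \<open>M/2 - n\<close> on \<open>E\<close>, and both lie between 0 and \<open>M/2\<close>.\<close>

lemma AW_star_halving:
  fixes c :: "'a::cstar_algebra"
  assumes AW: "AW_star TYPE('a)" and c: "positive_el c" "norm c \<le> M"
  obtains e where "is_projection e" "positive_el (c - (M/2) *\<^sub>R e)" "norm (c - (M/2) *\<^sub>R e) \<le> M/2"
proof -
  have M: "0 \<le> M" using c(2) norm_ge_zero order_trans by blast
  define h where "h = c - (M/2) *\<^sub>R 1"
  have hsa: "cstar h = h" using c(1) by (simp add: h_def cstar_simps positive_el_self_adjoint)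
  have "positive_el (M *\<^sub>R 1 - c)" using c positive_el_norm_diff positive_el_self_adjoint by blast
  moreover have "(M/2) *\<^sub>R 1 - h = M *\<^sub>R 1 - c" "(M/2) *\<^sub>R 1 + h = c"
    by (simp_all add: h_def algebra_simps flip: scaleR_add_left)
  ultimately have "norm h \<le> M/2" using M c hsa by (intro norm_le_two_sided) simp_all
  moreover obtain p n where pn: "h = p - n" "positive_el p" "positive_el n" "p * n = 0" "n * p = 0"
      and pnh: "norm p \<le> norm h" "norm n \<le> norm h"
    by (rule positive_negative_parts[OF hsa])
  ultimately have pnM: "norm p \<le> M/2" "norm n \<le> M/2" by auto
  obtain E where E: "is_projection E" "\<And>a. p * a = 0 \<longleftrightarrow> E * a = a"
    using AW_star_annihilator[OF AW, of "{p}"] by auto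
  have EE: "E * E = E" "cstar E = E" using E by (auto simp: is_projection_def)
  have nsa: "cstar n = n" "cstar p = p" using pn positive_el_self_adjoint by auto
  have En: "E * n = n" using E pn by blast
  have nE: "n * E = n" using arg_cong[OF En, of cstar] EE nsa by (simp add: cstar_mult)
  have pE: "p * E = 0" using E EE by blast
  have Ep: "E * p = 0" using arg_cong[OF pE, of cstar] EE nsa by (simp add: cstar_mult)
  define e where "e = 1 - E"
  have e: "is_projection e" using E by (simp add: e_def is_projection_complement)
  have ec: "c - (M/2) *\<^sub>R e = p + ((M/2) *\<^sub>R E - n)"
    using pn(1) by (simp add: e_def h_def algebra_simps)
  have "positive_el ((M/2) *\<^sub>R 1 - n)" using pnM nsa positive_el_norm_diff by blast
  from positive_el_compress[OF this E(1)]
  have "positive_el ((M/2) *\<^sub>R E - n)" by (simp add: algebra_simps EE En nE)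
  then have pos: "positive_el (c - (M/2) *\<^sub>R e)" unfolding ec using pn positive_el_add by blast
  have "positive_el ((M/2) *\<^sub>R 1 - p)" using pnM nsa positive_el_norm_diff by blast
  from positive_el_compress[OF this e]
  have "positive_el ((M/2) *\<^sub>R 1 - (M/2) *\<^sub>R E - p)"
    by (simp add: e_def algebra_simps EE Ep pE)
  from positive_el_add[OF this pn(3)]
  have "positive_el ((M/2) *\<^sub>R 1 - (c - (M/2) *\<^sub>R e))" unfolding ec by (simp add: algebra_simps)
  then have "norm (c - (M/2) *\<^sub>R e) \<le> M/2" using pos M by (intro norm_le_scaleR_one) simp_all
  then show ?thesis using that e pos by blast
qed

text \<open>Iterated halving expands \<open>c\<close> in binary digits that are projections.\<close>

lemma AW_star_approx_positive:
  fixes c :: "'a::cstar_algebra"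
  assumes AW: "AW_star TYPE('a)" and V: "\<And>p. is_projection p \<Longrightarrow> p \<in> V"
    "\<And>x y. x \<in> V \<Longrightarrow> y \<in> V \<Longrightarrow> x + y \<in> V" "\<And>r x. x \<in> V \<Longrightarrow> r *\<^sub>R x \<in> V"
  shows "positive_el c \<Longrightarrow> norm c \<le> M \<Longrightarrow> \<exists>s\<in>V. norm (c - s) \<le> M / 2 ^ n"
proof (induction n arbitrary: c M)
  case 0
  then show ?case using V(1)[of 0] by (intro bexI[of _ 0]) auto
next
  case (Suc n)
  obtain e where e: "is_projection e" "positive_el (c - (M/2) *\<^sub>R e)" "norm (c - (M/2) *\<^sub>R e) \<le> M/2"
    using AW_star_halving[OF AW Suc.prems] by blast
  obtain s where s: "s \<in> V" "norm (c - (M/2) *\<^sub>R e - s) \<le> (M/2) / 2 ^ n"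
    using Suc.IH[OF e(2,3)] by blast
  show ?case
  proof (rule bexI[of _ "(M/2) *\<^sub>R e + s"])
    show "norm (c - ((M/2) *\<^sub>R e + s)) \<le> M / 2 ^ Suc n" using s(2) by (simp add: algebra_simps)
    show "(M/2) *\<^sub>R e + s \<in> V" using V e s by blast
  qed
qed

lemma exists_half_power_less: "0 < (e::real) \<Longrightarrow> \<exists>n. M / 2 ^ n < e"
proof -
  assume "0 < e"
  have "(\<lambda>n. M * (1/2) ^ n) \<longlonglongrightarrow> M * 0" by (intro tendsto_mult tendsto_const LIMSEQ_realpow_zero) auto
  then have "eventually (\<lambda>n. M * (1/2) ^ n < e) sequentially"
    using \<open>0 < e\<close> by (intro order_tendstoD) auto
  then obtain n where "M * (1/2) ^ n < e" by (auto simp: eventually_sequentially)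
  then show ?thesis by (auto simp: power_one_over field_simps intro!: exI[of _ n])
qed

lemma cartesian_decomposition:
  fixes x :: "'a::cstar_algebra"
  obtains h k where "cstar h = h" "cstar k = k" "x = h + scaleC \<i> k"
proof (rule that)
  let ?h = "(1/2) *\<^sub>R (x + cstar x)"
  let ?k = "scaleC (-\<i>) ((1/2) *\<^sub>R (x - cstar x))"
  have i: "scaleC (-\<i>) u = - scaleC \<i> u" for u :: 'a
    using scaleC_minus_one[of "scaleC \<i> u"] by (simp add: scaleC_scaleC)
  show "cstar ?h = ?h" by (simp add: cstar_simps add.commute)
  show "cstar ?k = ?k" unfolding cstar_scaleC
    by (simp add: cstar_simps i scaleR_diff_right scaleC_diff_right)
  show "x = ?h + scaleC \<i> ?k"
    by (simp add: scaleC_scaleC scaleC_one algebra_simps flip: scaleR_add_left)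
qed

text \<open>The cartesian decomposition and a shift by \<open>norm h\<close> reduce everything to
  positive elements. The subspace \<open>V\<close> is left arbitrary, since it serves as a commutant
  and as the domain and the range of a graph.\<close>

lemma AW_star_dense:
  fixes x :: "'a::cstar_algebra"
  assumes AW: "AW_star TYPE('a)" and V: "\<And>p. is_projection p \<Longrightarrow> p \<in> V"
    "\<And>x y. x \<in> V \<Longrightarrow> y \<in> V \<Longrightarrow> x + y \<in> V" "\<And>c x. x \<in> V \<Longrightarrow> scaleC c x \<in> V"
    and e: "0 < e"
  shows "\<exists>s\<in>V. norm (x - s) < e"
proof -
  have VR: "r *\<^sub>R x \<in> V" if "x \<in> V" for r x using V(3) that by (simp add: scaleR_scaleC)
  have pos: "\<exists>s\<in>V. norm (c - s) < d" if "positive_el c" "d > 0" for c d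
    using AW_star_approx_positive[OF AW V(1,2) VR that(1) order_refl] exists_half_power_less[OF that(2), of "norm c"]
    by (meson le_less_trans)
  have sa: "\<exists>s\<in>V. norm (h - s) < d" if "cstar h = h" "d > 0" for h d
  proof -
    have "positive_el (norm h *\<^sub>R 1 + h)" using positive_el_norm_diff[of "- h" "norm h"] that by (simp add: cstar_minus)
    then obtain s where s: "s \<in> V" "norm (norm h *\<^sub>R 1 + h - s) < d" using pos \<open>d > 0\<close> by blast
    have "(- norm h) *\<^sub>R 1 + s \<in> V" using V VR s(1) by (meson is_projection_one)
    moreover have "h - ((- norm h) *\<^sub>R 1 + s) = norm h *\<^sub>R 1 + h - s" by simp
    ultimately show ?thesis using s by metis
  qed
  obtain h k where hk: "cstar h = h" "cstar k = k" "x = h + scaleC \<i> k" by (rule cartesian_decomposition)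
  obtain s where s: "s \<in> V" "norm (h - s) < e/2" using sa[OF hk(1), of "e/2"] e by auto
  obtain t where t: "t \<in> V" "norm (k - t) < e/2" using sa[OF hk(2), of "e/2"] e by auto
  have "x - (s + scaleC \<i> t) = (h - s) + scaleC \<i> (k - t)" by (simp add: hk scaleC_diff_right)
  then have "norm (x - (s + scaleC \<i> t)) < e"
    using s(2) t(2) norm_triangle_lt[of "h - s" "scaleC \<i> (k - t)" e] by (simp only: norm_scaleC) simp
  then show ?thesis using V s t by blast
qed

text \<open>The commutant of \<open>y\<close> is a subspace containing the projections, hence dense,
  and the commutator with \<open>y\<close> depends continuously on \<open>x\<close>.\<close>

lemma AW_star_commute_projections:
  fixes x y :: "'a::cstar_algebra"
  assumes AW: "AW_star TYPE('a)" and p: "\<And>p. is_projection p \<Longrightarrow> p * y = y * p"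
  shows "x * y = y * x"
proof -
  let ?V = "{v. v * y = y * v}"
  have "norm (x * y - y * x) \<le> 0 + e" if e: "e > 0" for e
  proof -
    define d where "d = e / (2 * norm y + 1)"
    have d: "d > 0" "d * (2 * norm y) \<le> e"
      using e by (auto simp: d_def divide_simps mult_left_mono add_nonneg_pos)
    obtain v where v: "v * y = y * v" "norm (x - v) < d"
      using AW_star_dense[OF AW _ _ _ d(1), of ?V x] p
      by (auto simp: distrib_left distrib_right mult_scaleC_left mult_scaleC_right)
    have "x * y - y * x = (x - v) * y - y * (x - v)" using v(1) by (simp add: algebra_simps)
    then have "norm (x * y - y * x) \<le> norm ((x - v) * y) + norm (y * (x - v))"
      by (simp add: norm_triangle_ineq4)
    also have "\<dots> \<le> norm (x - v) * (2 * norm y)"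
      using norm_mult_ineq[of "x - v" y] norm_mult_ineq[of y "x - v"] by (simp add: algebra_simps)
    also have "\<dots> \<le> d * (2 * norm y)" using v(2) by (intro mult_right_mono) auto
    finally show ?thesis using d(2) by simp
  qed
  then have "norm (x * y - y * x) \<le> 0" by (rule field_le_epsilon)
  then show ?thesis by simp
qed

text \<open>Density is used twice: projections first commute with all elements, and then all
  elements commute with each other.\<close>

lemma AW_star_commutative_if_projections_commute:
  assumes AW: "AW_star TYPE('a::cstar_algebra)"
    and p: "\<And>p q :: 'a. is_projection p \<Longrightarrow> is_projection q \<Longrightarrow> p * q = q * p"
  shows "(x::'a) * y = y * x"
proof -
  have "p * z = z * p" if "is_projection p" for p z :: 'a
    using AW_star_commute_projections[OF AW, of p z] p that by metis
  then show ?thesis using AW_star_commute_projections[OF AW] by blast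
qed

text \<open>Otherwise every projection \<open>e\<close> with a positive multiple below
  \<open>c\<close> satisfies \<open>e * q = 0\<close>. Repeated halving of \<open>c\<close> then
  never changes the product with \<open>q\<close>, whereas the norms of the remainders tend to zero,
  forcing \<open>c * q = 0\<close>.\<close>

lemma AW_star_dominated_projection:
  fixes c q :: "'a::cstar_algebra"
  assumes AW: "AW_star TYPE('a)" and c: "positive_el c" and q: "is_projection q" "c * q \<noteq> 0"
  obtains e d where "is_projection e" "0 < d" "positive_el (c - d *\<^sub>R e)" "e * q \<noteq> 0"
proof (rule ccontr)
  assume "\<not> thesis"
  then have neg: "\<And>e d. is_projection e \<Longrightarrow> 0 < d \<Longrightarrow> positive_el (c - d *\<^sub>R e) \<Longrightarrow> e * q = 0"
    using that by blast
  \<comment> \<open>The remainder \<open>b\<close> replaces \<open>c\<close> in the induction; it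
    stays below \<open>c\<close>, so projections split off from it are still dominated by
    \<open>c\<close>.\<close>
  have *: "norm (b * q) \<le> M / 2 ^ n"
    if "positive_el b" "positive_el (c - b)" "norm b \<le> M" "0 < M" for b M n
    using that
  proof (induction n arbitrary: b M)
    case 0
    have "norm (b * q) \<le> norm b * norm q" by (rule norm_mult_ineq)
    also have "\<dots> \<le> norm b * 1" by (intro mult_left_mono norm_projection_le q) simp
    finally show ?case using 0 by simp
  next
    case (Suc n)
    obtain e where e: "is_projection e" "positive_el (b - (M/2) *\<^sub>R e)" "norm (b - (M/2) *\<^sub>R e) \<le> M/2"
      using AW_star_halving[OF AW Suc.prems(1,3)] by blast
    have "positive_el (c - (M/2) *\<^sub>R e)" using positive_el_trans[OF e(2) Suc.prems(2)] .
    then have "e * q = 0" using neg[OF e(1), of "M/2"] Suc.prems(4) by simp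
    then have bq: "(b - (M/2) *\<^sub>R e) * q = b * q" by (simp add: algebra_simps)
    have "positive_el ((M/2) *\<^sub>R e)" using e(1) Suc.prems(4) by (simp add: positive_el_scaleR positive_el_projection)
    from positive_el_add[OF Suc.prems(2) this]
    have "positive_el (c - (b - (M/2) *\<^sub>R e))" by (simp add: algebra_simps)
    from Suc.IH[OF e(2) this e(3)] show ?case using Suc.prems(4) bq by simp
  qed
  have "norm (c * q) \<le> 0 + e" if "e > 0" for e
  proof -
    obtain n where "(norm c + 1) / 2 ^ n < e" using exists_half_power_less[OF \<open>e > 0\<close>] by blast
    moreover have "norm (c * q) \<le> (norm c + 1) / 2 ^ n"
      using c by (intro *) (auto simp: add_nonneg_pos)
    ultimately show ?thesis by simp
  qed
  then have "norm (c * q) \<le> 0" by (rule field_le_epsilon)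
  then show False using q by simp
qed

text \<open>The annihilator projection of \<open>1 - p\<close> and \<open>1 - q\<close> is the
  infimum of \<open>p\<close> and \<open>q\<close>. The support arguments use that it absorbs every
  element absorbed by both.\<close>

lemma AW_star_meet:
  fixes p q :: "'a::cstar_algebra"
  assumes AW: "AW_star TYPE('a)" and "is_projection p" "is_projection q"
  obtains m where "is_projection m" "p * m = m" "q * m = m" "m * p = m" "m * q = m"
    "\<And>a. p * a = a \<Longrightarrow> q * a = a \<Longrightarrow> m * a = a"
proof -
  obtain m where m: "is_projection m" "\<And>a. (1 - p) * a = 0 \<and> (1 - q) * a = 0 \<longleftrightarrow> m * a = a"
    using AW_star_annihilator[OF AW, of "{1 - p, 1 - q}"] by auto
  have m': "p * a = a \<and> q * a = a \<longleftrightarrow> m * a = a" for a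
    using m(2)[of a] by (auto simp: algebra_simps)
  have *: "p * m = m" "q * m = m" using m' m(1) by (auto simp: is_projection_def)
  moreover have "m * p = m" "m * q = m"
    using arg_cong[OF *(1), of cstar] arg_cong[OF *(2), of cstar] assms m(1)
    by (auto simp: cstar_mult is_projection_def)
  ultimately show ?thesis using that m(1) m' by blast
qed

section \<open>Order isomorphisms force commutativity\<close>

text \<open>For \<open>a = b + r q\<close> with \<open>q\<close> a projection and \<open>r > 0\<close>, the first set below consists of
  elements of \<open>b + q\<A>q\<close>. The second definition compares
  the supports of \<open>a - b\<close> and \<open>a' - b'\<close> at two different base points \<open>b \<le> b'\<close>. Both are phrased
  by means of the order alone, hence are transported by order isomorphisms.\<close>

definition support_cone :: "'a::cstar_algebra set \<Rightarrow> 'a \<Rightarrow> 'a \<Rightarrow> 'a set" where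
  "support_cone S b a = {c \<in> S. cstar_le b c \<and>
     (\<forall>c'\<in>S. cstar_le b c' \<and> cstar_le c' c \<and> c' \<noteq> b \<longrightarrow>
       (\<exists>d\<in>S. d \<noteq> b \<and> cstar_le b d \<and> cstar_le d c' \<and> cstar_le d a))}"

definition support_le :: "'a::cstar_algebra set \<Rightarrow> 'a \<Rightarrow> 'a \<Rightarrow> 'a \<Rightarrow> 'a \<Rightarrow> bool" where
  "support_le S b a b' a' \<longleftrightarrow>
     (\<forall>w\<in>support_cone S b a. \<exists>z\<in>support_cone S b' a'. cstar_le w z)"

lemma support_cone_subset: "support_cone S b a \<subseteq> S"
  by (auto simp: support_cone_def)

lemma support_cone_transport:
  assumes "inj_on f S" "\<And>x y. x \<in> S \<Longrightarrow> y \<in> S \<Longrightarrow> cstar_le (f x) (f y) \<longleftrightarrow> cstar_le x y"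
    and "b \<in> S" "a \<in> S"
  shows "support_cone (f ` S) (f b) (f a) = f ` support_cone S b a"
  using assms by (auto simp: support_cone_def inj_on_eq_iff image_iff)

lemma support_le_transport:
  assumes "inj_on f S" "\<And>x y. x \<in> S \<Longrightarrow> y \<in> S \<Longrightarrow> cstar_le (f x) (f y) \<longleftrightarrow> cstar_le x y"
    and "b \<in> S" "a \<in> S" "b' \<in> S" "a' \<in> S"
  shows "support_le (f ` S) (f b) (f a) (f b') (f a') \<longleftrightarrow> support_le S b a b' a'"
  using assms support_cone_subset[of S b a] support_cone_subset[of S b' a']
  by (simp add: support_le_def support_cone_transport) (meson subsetD)

lemma support_cone_translate:
  fixes v :: "'a::cstar_algebra"
  assumes v: "cstar v = v" and c: "c \<in> support_cone self_adjoint_part b a"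
  shows "c + v \<in> support_cone self_adjoint_part (b + v) (a + v)"
proof -
  let ?S = "self_adjoint_part :: 'a set"
  have S: "x + v \<in> ?S" "x - v \<in> ?S" if "x \<in> ?S" for x
    using that v by (auto simp: self_adjoint_part_def cstar_simps)
  have "\<exists>d\<in>?S. d \<noteq> b + v \<and> cstar_le (b + v) d \<and> cstar_le d c' \<and> cstar_le d (a + v)"
    if c': "c' \<in> ?S" "cstar_le (b + v) c'" "cstar_le c' (c + v)" "c' \<noteq> b + v" for c'
  proof -
    have "c' - v \<in> ?S" "cstar_le b (c' - v)" "cstar_le (c' - v) c" "c' - v \<noteq> b"
      using c' S by (auto simp: cstar_le_def algebra_simps)
    then obtain d where "d \<in> ?S" "d \<noteq> b" "cstar_le b d" "cstar_le d (c' - v)" "cstar_le d a"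
      using c unfolding support_cone_def by blast
    then show ?thesis using S by (intro bexI[of _ "d + v"]) (auto simp: cstar_le_def algebra_simps)
  qed
  then show ?thesis using c S unfolding support_cone_def by (auto simp: cstar_le_def)
qed

text \<open>The fourth vertex is \<open>l - x' + x\<close>. Translation by \<open>x' - l\<close>
  carries the support cone at this vertex into the one at \<open>x\<close>, and moves each of its
  points upwards because \<open>l \<le> x'\<close>.\<close>

lemma self_adjoint_parallelogram:
  fixes x x' l :: "'a::cstar_algebra"
  assumes "x \<in> self_adjoint_part" "x' \<in> self_adjoint_part" "l \<in> self_adjoint_part"
    and "cstar_le x x'" "cstar_le l x'"
  shows "\<exists>l'\<in>self_adjoint_part. cstar_le l' x \<and> cstar_le l' l \<and> support_le self_adjoint_part l' l x x'"
proof (rule bexI[of _ "l - x' + x"], intro conjI)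
  let ?l = "l - x' + x"
  have sa: "cstar x = x" "cstar x' = x'" "cstar l = l" using assms by (auto simp: self_adjoint_part_def)
  show "?l \<in> self_adjoint_part" using sa by (simp add: self_adjoint_part_def cstar_simps)
  show "cstar_le ?l x" "cstar_le ?l l" using assms by (auto simp: cstar_le_def algebra_simps)
  show "support_le self_adjoint_part ?l l x x'"
    unfolding support_le_def
  proof
    fix w assume "w \<in> support_cone self_adjoint_part ?l l"
    then have "w + (x' - l) \<in> support_cone self_adjoint_part (?l + (x' - l)) (l + (x' - l))"
      using sa by (intro support_cone_translate) (simp_all add: cstar_simps)
    then have "w + (x' - l) \<in> support_cone self_adjoint_part x x'" by simp
    moreover have "cstar_le w (w + (x' - l))" using assms by (simp add: cstar_le_def)
    ultimately show "\<exists>z\<in>support_cone self_adjoint_part x x'. cstar_le w z" by blast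
  qed
qed

section \<open>Support cones in the positive invertible part\<close>

text \<open>Otherwise \<open>z - x\<close> dominates \<open>s e\<close> for a projection
  \<open>e\<close> with \<open>e * (1 - q) \<noteq> 0\<close>, and \<open>p = e - m\<close> is
  nonzero for the meet \<open>m\<close> of \<open>e\<close> and \<open>q\<close>. The cone condition
  at \<open>x + s p\<close> yields a nonzero \<open>w\<close> below multiples of \<open>p\<close>
  and of \<open>q\<close>; it is absorbed by \<open>e\<close> and \<open>q\<close>, hence by
  \<open>m\<close>, but also by \<open>p\<close>, which is orthogonal to \<open>m\<close>.\<close>

lemma support_cone_projection:
  fixes q x z :: "'a::cstar_algebra"
  assumes AW: "AW_star TYPE('a)" and q: "is_projection q" and x: "x \<in> positive_invertible_part"
    and z: "z \<in> support_cone positive_invertible_part x (x + r *\<^sub>R q)"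
  shows "(z - x) * (1 - q) = 0"
proof (rule ccontr)
  assume ne: "(z - x) * (1 - q) \<noteq> 0"
  have q': "is_projection (1 - q)" using q by (rule is_projection_complement)
  have pos: "positive_el (z - x)" using z by (simp add: support_cone_def cstar_le_def)
  obtain e s where e: "is_projection e" "0 < s" "positive_el (z - x - s *\<^sub>R e)" "e * (1 - q) \<noteq> 0"
    using AW_star_dominated_projection[OF AW pos q' ne] by blast
  obtain m where m: "is_projection m" "e * m = m" "q * m = m" "m * e = m" "m * q = m"
      "\<And>a. e * a = a \<Longrightarrow> q * a = a \<Longrightarrow> m * a = a"
    using AW_star_meet[OF AW e(1) q] by blast
  define p where "p = e - m"
  have ee: "e * e = e" "m * m = m" "cstar e = e" "cstar m = m" "q * q = q"
    using e(1) m(1) q by (auto simp: is_projection_def)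
  have p: "is_projection p" using ee m by (simp add: p_def is_projection_def cstar_simps algebra_simps)
  have "p \<noteq> 0"
  proof
    assume "p = 0"
    then have "e * (1 - q) = m * (1 - q)" by (simp add: p_def)
    then show False using e(4) m(5) by (simp add: algebra_simps)
  qed
  have "positive_el (s *\<^sub>R p)" using e(2) p by (simp add: positive_el_scaleR positive_el_projection)
  moreover have "positive_el (z - x - s *\<^sub>R p)"
  proof -
    have "positive_el (s *\<^sub>R m)" using e(2) m(1) by (simp add: positive_el_scaleR positive_el_projection)
    from positive_el_add[OF e(3) this] show ?thesis by (simp add: p_def algebra_simps)
  qed
  ultimately have "cstar_le x (x + s *\<^sub>R p)" "cstar_le (x + s *\<^sub>R p) z" "x + s *\<^sub>R p \<noteq> x"
      "x + s *\<^sub>R p \<in> positive_invertible_part"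
    using \<open>p \<noteq> 0\<close> e(2) positive_invertible_part_upward[OF x, of "x + s *\<^sub>R p"]
    by (auto simp: cstar_le_def algebra_simps)
  then obtain d where d: "d \<noteq> x" "cstar_le x d" "cstar_le d (x + s *\<^sub>R p)" "cstar_le d (x + r *\<^sub>R q)"
    using z unfolding support_cone_def by blast
  define w where "w = d - x"
  have w: "positive_el w" "positive_el (s *\<^sub>R p - w)" "positive_el (r *\<^sub>R q - w)" "w \<noteq> 0"
    using d by (simp_all add: w_def cstar_le_def algebra_simps)
  have "(1 - p) * w = 0"
    by (rule positive_el_below_compress_zero[OF w(1,2) is_projection_complement[OF p]])
      (use p in \<open>simp add: is_projection_def algebra_simps\<close>)
  then have pw: "p * w = w" by (simp add: algebra_simps)
  have "(1 - q) * w = 0"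
    by (rule positive_el_below_compress_zero[OF w(1,3) q']) (simp add: ee algebra_simps)
  then have qw: "q * w = w" by (simp add: algebra_simps)
  have "e * p = p" by (simp add: p_def algebra_simps ee m)
  then have "e * w = w" using pw by (metis mult.assoc)
  then have "m * w = w" using m(6) qw by blast
  moreover have "p * m = 0" by (simp add: p_def algebra_simps ee m)
  ultimately have "p * w = 0" by (metis mult.assoc mult_zero_left)
  then show False using pw w(4) by simp
qed

text \<open>For \<open>c'\<close> below the far point of the ray, the witness is
  \<open>b + (c' - b) / t\<close>: shrinking by \<open>t \<ge> 1\<close> keeps it below
  \<open>c'\<close> and brings it below \<open>a\<close>.\<close>

lemma support_cone_ray:
  fixes b a :: "'a::cstar_algebra"
  assumes b: "b \<in> positive_invertible_part" and ba: "cstar_le b a" and t: "1 \<le> t"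
  shows "b + t *\<^sub>R (a - b) \<in> support_cone positive_invertible_part b a"
proof -
  let ?S = "positive_invertible_part :: 'a set"
  have w: "positive_el (a - b)" using ba by (simp add: cstar_le_def)
  then have tw: "positive_el (t *\<^sub>R (a - b))" using t by (simp add: positive_el_scaleR)
  have up: "c \<in> ?S" if "positive_el (c - b)" for c using positive_invertible_part_upward[OF b that] .
  have "\<exists>d\<in>?S. d \<noteq> b \<and> cstar_le b d \<and> cstar_le d c' \<and> cstar_le d a"
    if c': "cstar_le b c'" "cstar_le c' (b + t *\<^sub>R (a - b))" "c' \<noteq> b" for c'
  proof (intro bexI conjI)
    let ?d = "b + (1/t) *\<^sub>R (c' - b)"
    have c: "positive_el (c' - b)" using c' by (simp add: cstar_le_def)
    then have d: "positive_el ((1/t) *\<^sub>R (c' - b))" using t by (intro positive_el_scaleR) auto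
    then show "cstar_le b ?d" "?d \<in> ?S" using up by (auto simp: cstar_le_def)
    show "?d \<noteq> b" using c' t by simp
    have "positive_el ((1 - 1/t) *\<^sub>R (c' - b))" using t c by (intro positive_el_scaleR) auto
    then show "cstar_le ?d c'" by (simp add: cstar_le_def algebra_simps)
    have "positive_el (b + t *\<^sub>R (a - b) - c')" using c'(2) by (simp add: cstar_le_def)
    then have "positive_el ((1/t) *\<^sub>R (t *\<^sub>R (a - b) - (c' - b)))"
      using t by (intro positive_el_scaleR) (auto simp: algebra_simps)
    moreover have "(1/t) *\<^sub>R (t *\<^sub>R (a - b) - (c' - b)) = a - ?d"
      using t by (simp add: scaleR_diff_right[of _ "t *\<^sub>R _"])
    ultimately show "cstar_le ?d a" by (simp add: cstar_le_def)
  qed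
  then show ?thesis using up tw unfolding support_cone_def by (auto simp: cstar_le_def)
qed

text \<open>For every \<open>t \<ge> 1\<close> the support relation provides a \<open>z\<close>
  above \<open>l' + t (l - l')\<close> whose product with \<open>1 - q\<close> is that of
  \<open>x\<close>. Compression by \<open>1 - q\<close> bounds \<open>t\<close> times the corner of
  \<open>l - l'\<close> independently of \<open>t\<close>, so this corner vanishes.\<close>

lemma support_le_projection:
  fixes q :: "'a::cstar_algebra"
  assumes AW: "AW_star TYPE('a)" and q: "is_projection q"
    and x: "x \<in> positive_invertible_part" and l': "l' \<in> positive_invertible_part"
    and l'l: "cstar_le l' l" and T: "support_le positive_invertible_part l' l x (x + r *\<^sub>R q)"
  shows "(l - l') * (1 - q) = 0"
proof -
  let ?q = "1 - q" and ?w = "l - l'"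
  have q': "is_projection ?q" using q by (rule is_projection_complement)
  have w: "positive_el ?w" using l'l by (simp add: cstar_le_def)
  have bound: "t * norm (?q * ?w * ?q) \<le> norm (?q * (x - l') * ?q)" if t: "1 \<le> t" for t
  proof -
    obtain z where z: "z \<in> support_cone positive_invertible_part x (x + r *\<^sub>R q)"
        "positive_el (z - (l' + t *\<^sub>R ?w))"
      using T support_cone_ray[OF l' l'l t] unfolding support_le_def cstar_le_def by blast
    have zx: "z * ?q = x * ?q" using support_cone_projection[OF AW q x z(1)] by (simp add: left_diff_distrib)
    have "?q * (z - (l' + t *\<^sub>R ?w)) * ?q = ?q * (z * ?q) - ?q * l' * ?q - t *\<^sub>R (?q * ?w * ?q)"
      by (simp add: algebra_simps)
    also have "\<dots> = ?q * (x - l') * ?q - t *\<^sub>R (?q * ?w * ?q)"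
      unfolding zx by (simp add: right_diff_distrib left_diff_distrib mult.assoc)
    finally have "positive_el (?q * (x - l') * ?q - t *\<^sub>R (?q * ?w * ?q))"
      using positive_el_compress[OF z(2) q'] by simp
    moreover have "positive_el (t *\<^sub>R (?q * ?w * ?q))"
      using positive_el_compress[OF w q'] t by (simp add: positive_el_scaleR)
    ultimately show ?thesis using norm_mono_positive t by fastforce
  qed
  have "norm (?q * ?w * ?q) = 0"
  proof (rule ccontr)
    let ?N = "norm (?q * ?w * ?q)" and ?K = "norm (?q * (x - l') * ?q)"
    assume "?N \<noteq> 0"
    then have N: "?N > 0" by simp
    then have "1 \<le> ?K / ?N + 1" by simp
    from bound[OF this] show False using N by (simp add: field_simps)
  qed
  then show ?thesis using positive_el_compress_zero[OF w q'] by simp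
qed

text \<open>The property \<open>par\<close> is what an order isomorphism carries over from the
  self-adjoint part. The element \<open>b\<close> is fixed and only \<open>x\<close> varies with the
  small parameter, so the resulting bound on \<open>b\<close> tends to zero.\<close>

lemma offdiagonal_zero:
  fixes q y :: "'a::cstar_algebra"
  assumes AW: "AW_star TYPE('a)" and q: "is_projection q"
    and par: "\<And>x x' l :: 'a. x \<in> positive_invertible_part \<Longrightarrow> x' \<in> positive_invertible_part \<Longrightarrow>
      l \<in> positive_invertible_part \<Longrightarrow> cstar_le x x' \<Longrightarrow> cstar_le l x' \<Longrightarrow>
      \<exists>l'\<in>positive_invertible_part. cstar_le l' x \<and> cstar_le l' l \<and>
        support_le positive_invertible_part l' l x x'"
  shows "q * y * (1 - q) = 0"
proof -
  let ?q = "1 - q" and ?S = "positive_invertible_part :: 'a set"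
  have q': "is_projection ?q" using q by (rule is_projection_complement)
  have qq: "q * q = q" "cstar q = q" using q by (auto simp: is_projection_def)
  \<comment> \<open>The scaling makes \<open>norm b \<le> 1/4\<close>, hence
    \<open>norm h \<le> 1/2\<close>, so that \<open>1 + h\<close> lies between \<open>1/2\<close>
    and \<open>2\<close>.\<close>
  define k where "k = 1 / (4 * (norm (q * y * ?q) + 1))"
  have k: "k > 0" "k * norm (q * y * ?q) \<le> 1/4"
    by (auto simp: k_def divide_simps add_nonneg_pos)
  define b where "b = k *\<^sub>R (q * y * ?q)"
  have nb: "norm b \<le> 1/4" using k by (simp add: b_def)
  have qq': "q * (q * u) = q * u" for u by (simp add: qq flip: mult.assoc)
  have bq: "q * b = b" "b * q = 0" by (simp_all add: b_def algebra_simps qq qq')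
  have bsq: "q * cstar b = 0" using arg_cong[OF bq(2), of cstar] qq by (simp add: cstar_mult)
  define h where "h = b + cstar b"
  have hsa: "cstar h = h" by (simp add: h_def cstar_simps add.commute)
  have nh: "norm h \<le> 1/2" using norm_triangle_ineq[of b "cstar b"] nb by (simp add: h_def)
  have "positive_el ((1/2) *\<^sub>R 1 - (- h))" using nh hsa by (intro positive_el_norm_diff) (auto simp: cstar_minus)
  moreover have "(1/2) *\<^sub>R 1 - (- h) = (1 + h) - (1/2) *\<^sub>R 1" by (simp add: algebra_simps flip: scaleR_add_left)
  ultimately have l: "1 + h \<in> ?S" using positive_invertible_part_iff[of "1 + h"] by (metis zero_less_divide_1_iff zero_less_numeral)
  have "positive_el (1 *\<^sub>R 1 - h)" using nh hsa by (intro positive_el_norm_diff) auto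
  moreover have "2 *\<^sub>R 1 - (1 + h) = 1 *\<^sub>R 1 - h" unfolding scaleR_2 by simp
  ultimately have lx': "cstar_le (1 + h) (2 *\<^sub>R 1)" by (simp only: cstar_le_def)
  have "(norm b)\<^sup>2 \<le> 0 + d" if "d > 0" for d
  proof -
    define e where "e = min 1 (d/2)"
    have e: "0 < e" "e \<le> 1" "2 * e \<le> d" using that by (auto simp: e_def)
    \<comment> \<open>This is \<open>e * q + 2 * (1 - q)\<close>, written so that adding
      \<open>(2 - e) * q\<close> visibly gives the scalar 2.\<close>
    define x where "x = 2 *\<^sub>R 1 - (2 - e) *\<^sub>R q"
    have xx: "x + (2 - e) *\<^sub>R q = 2 *\<^sub>R 1" by (simp add: x_def)
    have "positive_el ((2 - e) *\<^sub>R ?q)" using e q' by (simp add: positive_el_scaleR positive_el_projection)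
    then have "positive_el (x - e *\<^sub>R 1)" by (simp add: x_def algebra_simps)
    then have x: "x \<in> ?S" using e(1) positive_invertible_part_iff by blast
    have "positive_el ((2 - e) *\<^sub>R q)" using e q by (simp add: positive_el_scaleR positive_el_projection)
    then have lex: "cstar_le x (x + (2 - e) *\<^sub>R q)" by (simp add: cstar_le_def)
    have x': "x + (2 - e) *\<^sub>R q \<in> ?S"
      using positive_invertible_part_upward[OF x] lex by (simp add: cstar_le_def)
    obtain l' where l': "l' \<in> ?S" "cstar_le l' x" "cstar_le l' (1 + h)"
        "support_le ?S l' (1 + h) x (x + (2 - e) *\<^sub>R q)"
      using par[OF x x' l lex] lx' unfolding xx by blast
    have "(1 + h - l') * ?q = 0" using support_le_projection[OF AW q x l'(1,3,4)] .
    then have "q * (l' * ?q) = q * ((1 + h) * ?q)" by (simp add: left_diff_distrib)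
    also have "\<dots> = b" by (simp add: h_def algebra_simps bq bsq qq)
      (simp add: bq bsq flip: mult.assoc)
    finally have qlq: "q * (l' * ?q) = b" .
    have l'pos: "positive_el l'" using l'(1) by (simp add: positive_invertible_part_def)
    then obtain s where s: "cstar s = s" "s * s = l'" by (rule positive_el_sqrt)
    have cmp: "norm (p * l' * p) \<le> norm (p * x * p)" if "is_projection p" for p
    proof (rule norm_mono_positive)
      show "positive_el (p * l' * p)" using positive_el_compress l'pos that by blast
      show "positive_el (p * x * p - p * l' * p)"
        using positive_el_compress[OF l'(2)[unfolded cstar_le_def] that] by (simp add: algebra_simps)
    qed
    have "q * x * q = e *\<^sub>R q" by (simp add: x_def algebra_simps qq)
    then have 1: "(norm (q * s))\<^sup>2 \<le> e"
      using cmp[OF q] norm_sqrt_mult_projection(2)[OF s(1) q] s(2) e norm_projection_le[OF q]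
      by (simp add: mult_left_le order_trans[of _ "e * norm q"])
    have "?q * x * ?q = 2 *\<^sub>R ?q" by (simp add: x_def algebra_simps qq)
    then have 2: "(norm (s * ?q))\<^sup>2 \<le> 2"
      using cmp[OF q'] norm_sqrt_mult_projection(1)[OF s(1) q'] s(2) norm_projection_le[OF q']
      by simp
    \<comment> \<open>A Cauchy-Schwarz estimate for the corner \<open>b = (q * s) * (s * ?q)\<close>
      of \<open>l' = s * s\<close>; the norms of the two diagonal corners of \<open>l'\<close> are
      bounded through \<open>x\<close> by \<open>e\<close> and 2.\<close>
    have "norm b \<le> norm (q * s) * norm (s * ?q)"
      using norm_mult_ineq[of "q * s" "s * ?q"] qlq s(2) by (simp add: mult.assoc) (metis mult.assoc)
    then have "(norm b)\<^sup>2 \<le> (norm (q * s) * norm (s * ?q))\<^sup>2" by (rule power_mono) simp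
    also have "\<dots> \<le> e * 2" unfolding power_mult_distrib using 1 2 e by (intro mult_mono) auto
    finally show ?thesis using e by simp
  qed
  then have "(norm b)\<^sup>2 \<le> 0" by (rule field_le_epsilon)
  then have "b = 0" by simp
  then show ?thesis using k(1) by (simp add: b_def)
qed

lemma order_isomorphic_commutative_right:
  fixes f :: "'a::cstar_algebra \<Rightarrow> 'b::cstar_algebra"
  assumes AW: "AW_star TYPE('b)" and bij: "bij_betw f self_adjoint_part positive_invertible_part"
    and ord: "\<And>x y. x \<in> self_adjoint_part \<Longrightarrow> y \<in> self_adjoint_part \<Longrightarrow> cstar_le x y \<longleftrightarrow> cstar_le (f x) (f y)"
  shows "(x::'b) * y = y * x"
proof -
  have inj: "inj_on f self_adjoint_part" and im: "f ` self_adjoint_part = positive_invertible_part"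
    using bij by (auto simp: bij_betw_def)
  have par: "\<exists>l'\<in>positive_invertible_part. cstar_le l' x \<and> cstar_le l' l \<and>
      support_le positive_invertible_part l' l x x'"
    if xl: "x \<in> positive_invertible_part" "x' \<in> positive_invertible_part"
      "l \<in> positive_invertible_part" "cstar_le x x'" "cstar_le l x'" for x x' l :: 'b
  proof -
    obtain u u' v where u: "u \<in> self_adjoint_part" "u' \<in> self_adjoint_part" "v \<in> self_adjoint_part"
        "x = f u" "x' = f u'" "l = f v"
      using xl unfolding im[symmetric] by blast
    then obtain v' where v': "v' \<in> self_adjoint_part" "cstar_le v' u" "cstar_le v' v"
        "support_le self_adjoint_part v' v u u'"
      using self_adjoint_parallelogram[of u u' v] ord xl by auto
    then have "support_le positive_invertible_part (f v') l x x'"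
      using support_le_transport[of f self_adjoint_part v' v u u', OF inj] u ord unfolding im by simp
    moreover have "f v' \<in> positive_invertible_part" using v'(1) im by blast
    ultimately show ?thesis using v' u ord by blast
  qed
  have central: "q * y = y * q" if q: "is_projection q" for q y :: 'b
  proof -
    \<comment> \<open>The corner \<open>(1 - q) * y * q\<close> is the adjoint of
      \<open>q * cstar y * (1 - q)\<close>, so both off-diagonal corners of \<open>y\<close>
      vanish.\<close>
    have "q * y * (1 - q) = 0" "q * cstar y * (1 - q) = 0"
      using offdiagonal_zero[OF AW q par] by blast+
    then have "q * y - q * y * q = 0" "q * cstar y - q * cstar y * q = 0"
      by (simp_all only: right_diff_distrib mult_1_right)
    then have "q * y = q * y * q" "q * cstar y = q * cstar y * q" unfolding right_minus_eq .
    moreover from arg_cong[OF this(2), of cstar] have "y * q = q * y * q"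
      using q by (simp add: is_projection_def cstar_simps mult.assoc)
    ultimately show ?thesis by simp
  qed
  show ?thesis using AW_star_commutative_if_projections_commute[OF AW] central by blast
qed

section \<open>Commutative algebras\<close>

text \<open>The element \<open>u - p\<close> is the minimum of \<open>u\<close> and
  \<open>v\<close>. Its negative part \<open>k\<close> vanishes: positivity of \<open>u * k\<close>
  and \<open>v * k\<close> becomes that of \<open>p * k - k * k\<close> and
  \<open>n * k - k * k\<close>, and a combination of these with positive coefficients collapses to
  minus the fourth power of \<open>k\<close>, because \<open>p * n = 0\<close>.\<close>

lemma positive_el_min:
  fixes u v p n :: "'a::cstar_algebra"
  assumes com: "\<And>x y :: 'a. x * y = y * x"
    and u: "positive_el u" and v: "positive_el v"
    and p: "positive_el p" and n: "positive_el n" "p * n = 0" "u - v = p - n"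
  shows "positive_el (u - p)"
proof -
  have lc: "x * (y * z) = y * (x * z)" for x y z :: 'a by (metis com mult.assoc)
  have sa: "cstar (u - p) = u - p" using u p by (simp add: cstar_diff positive_el_self_adjoint)
  obtain m k where mk: "u - p = m - k" "positive_el m" "positive_el k" "m * k = 0"
    by (rule positive_negative_parts[OF sa]) blast
  have ueq: "u = m - k + p" using mk(1) by (simp add: algebra_simps)
  have "v = (u - p) + n" using n(3) by (simp add: algebra_simps)
  then have veq: "v = m - k + n" using mk(1) by simp
  have "positive_el (u * k)" "positive_el (v * k)" using u v mk com by (auto intro: positive_el_mult)
  then have 1: "positive_el (p * k - k * k)" "positive_el (n * k - k * k)"
    using mk(4) by (simp_all add: ueq veq algebra_simps)
  have nk: "positive_el (n * k)" and kk: "positive_el (k * k)"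
    using n mk com by (auto intro: positive_el_mult)
  have "positive_el ((p * k - k * k) * (n * k) + k * k * (n * k - k * k))"
    using 1 nk kk n(1) mk(3) com by (intro positive_el_add positive_el_mult)
  moreover have "p * (n * x) = 0" for x using n(2) by (simp flip: mult.assoc)
  then have "(p * k - k * k) * (n * k) + k * k * (n * k - k * k) = - ((k * k) * (k * k))"
    by (simp add: algebra_simps com lc)
  ultimately have "positive_el (- ((k * k) * (k * k)))" by simp
  moreover have "positive_el ((k * k) * (k * k))" using kk positive_el_mult by blast
  ultimately have "(k * k) * (k * k) = 0" using positive_el_antisym by blast
  moreover have ksa: "cstar k = k" using mk positive_el_self_adjoint by blast
  ultimately have "k * k = 0"
    using norm_square_self_adjoint[of "k * k"] by (simp add: cstar_mult)
  then have "k = 0" using norm_square_self_adjoint[OF ksa] by simp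
  then show ?thesis using mk by simp
qed

text \<open>The infimum is \<open>a\<close> minus the positive part of \<open>a - b\<close>;
  shifting by a lower bound \<open>d\<close> reduces its maximality to
  \<open>positive_el_min\<close>. A small positive scalar \<open>e\<close> is itself a lower bound,
  which keeps the infimum in the positive invertible part.\<close>

lemma positive_invertible_part_inf:
  fixes a b :: "'a::cstar_algebra"
  assumes com: "\<And>x y :: 'a. x * y = y * x"
    and a: "a \<in> positive_invertible_part" and b: "b \<in> positive_invertible_part"
  obtains i where "i \<in> positive_invertible_part" "cstar_le i a" "cstar_le i b"
    "\<And>d. cstar_le d a \<Longrightarrow> cstar_le d b \<Longrightarrow> cstar_le d i"
proof -
  have sa: "cstar (a - b) = a - b"
    using a b by (simp add: cstar_diff positive_el_self_adjoint positive_invertible_part_def)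
  obtain p n where pn: "a - b = p - n" "positive_el p" "positive_el n" "p * n = 0"
    by (rule positive_negative_parts[OF sa]) blast
  have inf: "cstar_le d (a - p)" if "cstar_le d a" "cstar_le d b" for d
  proof -
    have "positive_el (a - d - p)"
      by (rule positive_el_min[OF com that[unfolded cstar_le_def] pn(2-4)]) (simp add: pn(1))
    then show ?thesis by (simp add: cstar_le_def algebra_simps)
  qed
  obtain e1 where e1: "e1 > 0" "positive_el (a - e1 *\<^sub>R 1)" using a positive_invertible_part_iff by blast
  obtain e2 where e2: "e2 > 0" "positive_el (b - e2 *\<^sub>R 1)" using b positive_invertible_part_iff by blast
  define e where "e = min e1 e2"
  have e: "e > 0" using e1 e2 by (simp add: e_def)
  have small: "positive_el (c - e *\<^sub>R 1)" if "positive_el (c - r *\<^sub>R 1)" "e \<le> r" for c :: 'a and r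
  proof -
    have "positive_el ((r - e) *\<^sub>R (1::'a))" using that(2) by (simp add: positive_el_scaleR)
    from positive_el_add[OF that(1) this] show ?thesis by (simp add: algebra_simps)
  qed
  have "cstar_le (e *\<^sub>R 1) a" "cstar_le (e *\<^sub>R 1) b"
    unfolding cstar_le_def using small e1 e2 by (auto simp: e_def)
  then have "cstar_le (e *\<^sub>R 1) (a - p)" by (rule inf)
  then have "a - p \<in> positive_invertible_part"
    using e positive_invertible_part_iff unfolding cstar_le_def by blast
  moreover have "cstar_le (a - p) a" using pn by (simp add: cstar_le_def)
  moreover have "b - (a - p) = n" using pn(1) by (simp add: algebra_simps)
  then have "cstar_le (a - p) b" using pn by (simp add: cstar_le_def)
  ultimately show ?thesis using inf that by blast
qed

text \<open>Infima of pairs in the target pull back along \<open>f\<close>. If zero is the only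
  positive element below both projections \<open>p\<close> and \<open>q\<close>, their infimum is
  zero, yet \<open>p + q - 1\<close> is a lower bound; thus \<open>p + q \<le> 1\<close>, and
  compression by \<open>q\<close> yields \<open>p * q = 0\<close>. The general case follows by
  removing the meet from \<open>p\<close>.\<close>

lemma order_isomorphic_commutative_left:
  fixes f :: "'a::cstar_algebra \<Rightarrow> 'b::cstar_algebra"
  assumes AW: "AW_star TYPE('a)" and com: "\<And>x y :: 'b. x * y = y * x"
    and bij: "bij_betw f self_adjoint_part positive_invertible_part"
    and ord: "\<And>x y. x \<in> self_adjoint_part \<Longrightarrow> y \<in> self_adjoint_part \<Longrightarrow> cstar_le x y \<longleftrightarrow> cstar_le (f x) (f y)"
  shows "(x::'a) * y = y * x"
proof (rule AW_star_commutative_if_projections_commute[OF AW])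
  have im: "f ` self_adjoint_part = positive_invertible_part" using bij by (simp add: bij_betw_def)
  have orth: "p * q = 0"
    if p: "is_projection p" and q: "is_projection q"
      and disj: "\<And>z. positive_el z \<Longrightarrow> positive_el (p - z) \<Longrightarrow> positive_el (q - z) \<Longrightarrow> z = 0" for p q :: 'a
  proof -
    have sa: "p \<in> self_adjoint_part" "q \<in> self_adjoint_part" "0 \<in> self_adjoint_part" "p + q - 1 \<in> self_adjoint_part"
      using p q by (auto simp: self_adjoint_part_def is_projection_def cstar_simps)
    obtain i where i: "i \<in> positive_invertible_part" "cstar_le i (f p)" "cstar_le i (f q)"
      "\<And>d. cstar_le d (f p) \<Longrightarrow> cstar_le d (f q) \<Longrightarrow> cstar_le d i"
      by (rule positive_invertible_part_inf[OF com, of "f p" "f q"]) (use sa im in blast)+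
    obtain z where z: "z \<in> self_adjoint_part" "i = f z" using i(1) im by blast
    have "cstar_le 0 p" "cstar_le 0 q" using p q by (simp_all add: cstar_le_def positive_el_projection)
    then have "cstar_le (f 0) i" using i ord sa by blast
    then have "cstar_le 0 z" "cstar_le z p" "cstar_le z q" using i ord sa z by auto
    then have "z = 0" using disj by (simp add: cstar_le_def)
    have "cstar_le (p + q - 1) p" "cstar_le (p + q - 1) q"
      using positive_el_projection[OF is_projection_complement] p q by (simp_all add: cstar_le_def)
    then have "cstar_le (f (p + q - 1)) i" using i ord sa by blast
    then have "cstar_le (p + q - 1) 0" using z \<open>z = 0\<close> ord sa by blast
    then have "positive_el (1 - p - q)" by (simp add: cstar_le_def algebra_simps)
    from positive_el_compress[OF this q] have "positive_el (- (q * p * q))"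
      using q by (simp add: is_projection_def algebra_simps)
    moreover have "positive_el (q * p * q)" using p q positive_el_compress positive_el_projection by blast
    ultimately have "q * p * q = 0" using positive_el_antisym by blast
    then show ?thesis using positive_el_compress_zero p q positive_el_projection by blast
  qed
  fix p q :: 'a
  assume p: "is_projection p" and q: "is_projection q"
  obtain m where m: "is_projection m" "p * m = m" "q * m = m" "m * p = m" "m * q = m"
      "\<And>a. p * a = a \<Longrightarrow> q * a = a \<Longrightarrow> m * a = a"
    using AW_star_meet[OF AW p q] by blast
  define r where "r = p - m"
  have pp: "p * p = p" "m * m = m" "cstar p = p" "cstar m = m" "q * q = q" "cstar q = q"
    using p m(1) q by (auto simp: is_projection_def)
  have r: "is_projection r" using pp m by (simp add: r_def is_projection_def cstar_simps algebra_simps)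
  have "r * q = 0"
  proof (rule orth[OF r q])
    fix z :: 'a assume z: "positive_el z" "positive_el (r - z)" "positive_el (q - z)"
    have "(1 - r) * z = 0"
      by (rule positive_el_below_compress_zero[OF z(1,2) is_projection_complement[OF r]])
        (use r in \<open>simp add: is_projection_def algebra_simps\<close>)
    then have rz: "r * z = z" by (simp add: algebra_simps)
    have "(1 - q) * z = 0"
      by (rule positive_el_below_compress_zero[OF z(1,3) is_projection_complement[OF q]])
        (simp add: pp algebra_simps)
    then have qz: "q * z = z" by (simp add: algebra_simps)
    have "p * r = r" by (simp add: r_def algebra_simps pp m)
    then have "p * z = z" using rz by (metis mult.assoc)
    then have "m * z = z" using m(6) qz by blast
    moreover have "r * m = 0" by (simp add: r_def algebra_simps pp m)
    ultimately have "r * z = 0" by (metis mult.assoc mult_zero_left)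
    then show "z = 0" using rz by simp
  qed
  then have pq: "p * q = m" using m by (simp add: r_def algebra_simps)
  have "q * p = m" using arg_cong[OF pq, of cstar] pp by (simp add: cstar_mult)
  then show "p * q = q * p" using pq by simp
qed

section \<open>Orthogonality and supports in terms of the order\<close>

text \<open>If \<open>a * c = 0\<close>, then \<open>(a - d) * c + d * (c - d) = - (d * d)\<close>
  is positive, so \<open>d = 0\<close>. Conversely \<open>a * c / K\<close> lies below both
  \<open>a\<close> and \<open>c\<close> once \<open>K\<close> exceeds their norms.\<close>

lemma mult_zero_iff_disjoint:
  fixes a c :: "'a::cstar_algebra"
  assumes com: "\<And>x y :: 'a. x * y = y * x" and a: "positive_el a" and c: "positive_el c"
  shows "a * c = 0 \<longleftrightarrow> (\<forall>d. positive_el d \<and> positive_el (a - d) \<and> positive_el (c - d) \<longrightarrow> d = 0)"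
proof (intro iffI allI impI)
  fix d :: 'a
  assume ac: "a * c = 0" and d: "positive_el d \<and> positive_el (a - d) \<and> positive_el (c - d)"
  have "positive_el ((a - d) * c + d * (c - d))"
    using d c com by (intro positive_el_add positive_el_mult) auto
  then have "positive_el (- (d * d))" using ac by (simp add: algebra_simps)
  moreover have dsa: "cstar d = d" using d positive_el_self_adjoint by blast
  ultimately have "d * d = 0" using positive_el_antisym positive_el_square by blast
  then show "d = 0" using norm_square_self_adjoint[OF dsa] by simp
next
  assume disj: "\<forall>d. positive_el d \<and> positive_el (a - d) \<and> positive_el (c - d) \<longrightarrow> d = 0"
  define K where "K = norm a + norm c + 1"
  have K: "K > 0" by (simp add: K_def add_nonneg_pos)
  have le: "positive_el (1 *\<^sub>R 1 - (1/K) *\<^sub>R x)" if "positive_el x" "norm x \<le> K" for x :: 'a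
    using that K by (intro positive_el_norm_diff) (auto simp: cstar_scaleR positive_el_self_adjoint)
  have "positive_el ((1/K) *\<^sub>R (a * c))" using K a c com by (intro positive_el_scaleR positive_el_mult) auto
  moreover have "positive_el (a * (1 *\<^sub>R 1 - (1/K) *\<^sub>R c))"
    using a c com le[of c] by (intro positive_el_mult) (auto simp: K_def)
  then have "positive_el (a - (1/K) *\<^sub>R (a * c))" by (simp add: algebra_simps)
  moreover have "positive_el ((1 *\<^sub>R 1 - (1/K) *\<^sub>R a) * c)"
    using a c com le[of a] by (intro positive_el_mult) (auto simp: K_def)
  then have "positive_el (c - (1/K) *\<^sub>R (a * c))" by (simp add: algebra_simps)
  ultimately have "(1/K) *\<^sub>R (a * c) = 0" using disj by blast
  then show "a * c = 0" using K by simp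
qed

text \<open>Subtracting \<open>f 0\<close> gives an order isomorphism between the positive cones:
  the positive invertible part is upward closed, so it contains \<open>f 0 + b\<close> for all
  positive \<open>b\<close>. Orthogonality is then preserved by its order characterization.\<close>

lemma order_isomorphic_preserves_orthogonality:
  fixes f :: "'a::cstar_algebra \<Rightarrow> 'b::cstar_algebra"
  assumes comA: "\<And>x y :: 'a. x * y = y * x" and comB: "\<And>x y :: 'b. x * y = y * x"
    and bij: "bij_betw f self_adjoint_part positive_invertible_part"
    and ord: "\<And>x y. x \<in> self_adjoint_part \<Longrightarrow> y \<in> self_adjoint_part \<Longrightarrow> cstar_le x y \<longleftrightarrow> cstar_le (f x) (f y)"
  defines "g \<equiv> \<lambda>a. f a - f 0"
  shows "\<And>a. positive_el a \<Longrightarrow> positive_el (g a)"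
    and "\<And>b. positive_el b \<Longrightarrow> \<exists>a. positive_el a \<and> g a = b"
    and "\<And>a c. positive_el a \<Longrightarrow> positive_el c \<Longrightarrow> a * c = 0 \<longleftrightarrow> g a * g c = 0"
proof -
  have im: "f ` self_adjoint_part = positive_invertible_part" and inj: "inj_on f self_adjoint_part"
    using bij by (auto simp: bij_betw_def)
  have sa: "a \<in> self_adjoint_part" if "positive_el a" for a :: 'a
    using that by (simp add: self_adjoint_part_def positive_el_self_adjoint)
  have le: "positive_el (c - a) \<longleftrightarrow> positive_el (g c - g a)" if "positive_el a" "positive_el c" for a c
    using ord[OF sa[OF that(1)] sa[OF that(2)]] by (simp add: cstar_le_def g_def)
  show pos: "positive_el (g a)" if "positive_el a" for a
    using le[of 0 a] that by (simp add: g_def)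
  show surj: "\<exists>a. positive_el a \<and> g a = b" if b: "positive_el b" for b
  proof -
    have "f 0 \<in> positive_invertible_part" using im sa[of 0] by auto
    then have "f 0 + b \<in> positive_invertible_part" using positive_invertible_part_upward[of "f 0" "f 0 + b"] b by simp
    then obtain u where u: "u \<in> self_adjoint_part" "f 0 + b = f u" using im by blast
    have "f u - f 0 = b" using u(2) by (metis add_diff_cancel_left')
    moreover have "cstar_le 0 u" using ord[OF sa[of 0] u(1)] b calculation by (simp add: cstar_le_def)
    ultimately show ?thesis by (auto simp: cstar_le_def g_def)
  qed
  have g0: "g d = 0 \<longleftrightarrow> d = 0" if "positive_el d" for d
    using inj_onD[OF inj, of d 0] sa that by (auto simp: g_def)
  show "a * c = 0 \<longleftrightarrow> g a * g c = 0" if a: "positive_el a" and c: "positive_el c" for a c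
  proof -
    have "(\<forall>d. positive_el d \<and> positive_el (a - d) \<and> positive_el (c - d) \<longrightarrow> d = 0) \<longleftrightarrow>
      (\<forall>d. positive_el d \<and> positive_el (g a - d) \<and> positive_el (g c - d) \<longrightarrow> d = 0)" (is "?L \<longleftrightarrow> ?R")
    proof
      assume L: ?L
      show ?R
      proof (intro allI impI)
        fix d assume d: "positive_el d \<and> positive_el (g a - d) \<and> positive_el (g c - d)"
        then obtain e where e: "positive_el e" "g e = d" using surj by blast
        then have "e = 0" using d le[OF e(1) a] le[OF e(1) c] L by blast
        then show "d = 0" using e by (simp add: g_def)
      qed
    next
      assume R: ?R
      show ?L
      proof (intro allI impI)
        fix d assume d: "positive_el d \<and> positive_el (a - d) \<and> positive_el (c - d)"
        then have "positive_el (g d)" "positive_el (g a - g d)" "positive_el (g c - g d)"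
          using pos le[of d a] le[of d c] a c by auto
        then have "g d = 0" using R by blast
        then show "d = 0" using g0 d by blast
      qed
    qed
    then show ?thesis
      by (simp only: mult_zero_iff_disjoint[OF comA a c] mult_zero_iff_disjoint[OF comB pos[OF a] pos[OF c]])
  qed
qed

lemma AW_star_support:
  fixes a :: "'a::cstar_algebra"
  assumes "AW_star TYPE('a)"
  obtains s where "is_projection s" "\<And>x. a * x = 0 \<longleftrightarrow> s * x = 0"
proof -
  obtain E where E: "is_projection E" "\<And>x. a * x = 0 \<longleftrightarrow> E * x = x"
    using AW_star_annihilator[OF assms, of "{a}"] by auto
  have "a * x = 0 \<longleftrightarrow> (1 - E) * x = 0" for x using E(2)[of x] by (auto simp: left_diff_distrib)
  then show ?thesis using that is_projection_complement[OF E(1)] by blast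
qed

lemma is_projection_mult:
  fixes p q :: "'a::cstar_algebra"
  assumes com: "\<And>x y :: 'a. x * y = y * x" and "is_projection p" "is_projection q"
  shows "is_projection (p * q)"
  using assms unfolding is_projection_def cstar_mult by (metis mult.assoc)

lemma projection_mult_complement: "is_projection r \<Longrightarrow> r * (1 - r) = 0"
  by (simp add: is_projection_def algebra_simps)

lemma mult_eq_left_iff_complement: "x * y = x \<longleftrightarrow> x * (1 - y) = (0::'a::ring_1)"
  by (auto simp: right_diff_distrib)

text \<open>The projection \<open>\<phi> p\<close> is the support of \<open>g p\<close>. Inclusion
  of projections means that positive elements annihilated by the larger are annihilated by the
  smaller, and \<open>g\<close> respects this; thus \<open>\<phi>\<close> is an order isomorphism of
  projections, and the order determines products and complements.\<close>

lemma boolean_isomorphism_of_orthogonality: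
  fixes g :: "'a::cstar_algebra \<Rightarrow> 'b::cstar_algebra"
  assumes AWA: "AW_star TYPE('a)" and AWB: "AW_star TYPE('b)"
    and comA: "\<And>x y :: 'a. x * y = y * x" and comB: "\<And>x y :: 'b. x * y = y * x"
    and pos: "\<And>a. positive_el a \<Longrightarrow> positive_el (g a)"
    and surj: "\<And>b. positive_el b \<Longrightarrow> \<exists>a. positive_el a \<and> g a = b"
    and orth: "\<And>a c. positive_el a \<Longrightarrow> positive_el c \<Longrightarrow> a * c = 0 \<longleftrightarrow> g a * g c = 0"
  obtains \<phi> :: "'a \<Rightarrow> 'b" where "\<And>p. is_projection p \<Longrightarrow> is_projection (\<phi> p)"
    "\<And>r. is_projection r \<Longrightarrow> \<exists>p. is_projection p \<and> \<phi> p = r"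
    "\<And>p. is_projection p \<Longrightarrow> \<phi> p = 0 \<longleftrightarrow> p = 0"
    "\<And>p q. is_projection p \<Longrightarrow> is_projection q \<Longrightarrow> \<phi> (p * q) = \<phi> p * \<phi> q"
    "\<And>p. is_projection p \<Longrightarrow> \<phi> (1 - p) = 1 - \<phi> p"
proof -
  have "\<exists>r. is_projection r \<and> (\<forall>x. g p * x = 0 \<longleftrightarrow> r * x = 0)" for p
    by (rule AW_star_support[OF AWB, of "g p"]) blast
  then obtain \<phi> where \<phi>: "\<And>p. is_projection (\<phi> p)" "\<And>p x. g p * x = 0 \<longleftrightarrow> \<phi> p * x = 0"
    by metis
  have key: "\<phi> p * g c = 0 \<longleftrightarrow> p * c = 0" if "is_projection p" "positive_el c" for p c
    using orth[of p c] \<phi>(2) that positive_el_projection by blast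
  note cp = positive_el_projection[OF is_projection_complement]
  note idem = projection_mult_complement
  note leI = mult_eq_left_iff_complement
  note pm = is_projection_mult[OF comA] and pmB = is_projection_mult[OF comB]
  have le: "p * q = p \<longleftrightarrow> \<phi> p * \<phi> q = \<phi> p" if p: "is_projection p" and q: "is_projection q" for p q
  proof
    assume pq: "p * q = p"
    obtain c where c: "positive_el c" "g c = 1 - \<phi> q" using surj cp \<phi>(1) by blast
    have "q * c = 0" using key[OF q c(1)] c(2) idem[OF \<phi>(1)[of q]] by simp
    then have "p * c = 0" using pq by (metis mult.assoc mult_zero_right)
    then have "\<phi> p * (1 - \<phi> q) = 0" using key[OF p c(1)] c(2) by simp
    then show "\<phi> p * \<phi> q = \<phi> p" unfolding leI .
  next
    assume pq: "\<phi> p * \<phi> q = \<phi> p"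
    have "\<phi> q * g (1 - q) = 0" using key[OF q cp[OF q]] idem[OF q] by blast
    then have "\<phi> p * g (1 - q) = 0" using pq by (metis mult.assoc mult_zero_right)
    then have "p * (1 - q) = 0" using key[OF p cp[OF q]] by blast
    then show "p * q = p" unfolding leI .
  qed
  have inj: "p = q" if "is_projection p" "is_projection q" "\<phi> p = \<phi> q" for p q
    using le[of p q] le[of q p] that \<phi>(1)[of q] comA[of p q] by (simp add: is_projection_def)
  have sur: "\<exists>p. is_projection p \<and> \<phi> p = r" if r: "is_projection r" for r
  proof -
    \<comment> \<open>The support \<open>s\<close> of a preimage of \<open>r\<close> works, because
      \<open>\<phi> s\<close> and \<open>r\<close> annihilate the same positive elements.\<close>
    obtain a where a: "positive_el a" "g a = r" using surj[OF positive_el_projection[OF r]] by blast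
    obtain s where s: "is_projection s" "\<And>x. a * x = 0 \<longleftrightarrow> s * x = 0"
      by (rule AW_star_support[OF AWA, of a]) blast
    have eq: "\<phi> s * d = 0 \<longleftrightarrow> r * d = 0" if d: "positive_el d" for d
    proof -
      obtain c where c: "positive_el c" "g c = d" using surj[OF d] by blast
      show ?thesis using key[OF s(1) c(1)] s(2)[of c] orth[OF a(1) c(1)] a(2) c(2) by simp
    qed
    have "\<phi> s * r = \<phi> s" "r * \<phi> s = r"
      unfolding leI using eq cp idem r \<phi>(1) by blast+
    then have "\<phi> s = r" using comB by metis
    then show ?thesis using s(1) by blast
  qed
  have z: "\<phi> 0 = 0"
  proof -
    obtain c where c: "positive_el c" "g c = 1" using surj[OF positive_el_one] by blast
    show ?thesis using key[OF is_projection_zero c(1)] c(2) by simp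
  qed
  have mult: "\<phi> (p * q) = \<phi> p * \<phi> q" if p: "is_projection p" and q: "is_projection q" for p q
  proof -
    have pq: "is_projection (p * q)" using pm p q .
    have "p * q * p = p * q" "p * q * q = p * q"
      using p q comA by (metis is_projection_def mult.assoc)+
    then have 1: "\<phi> (p * q) * \<phi> p = \<phi> (p * q)" "\<phi> (p * q) * \<phi> q = \<phi> (p * q)"
      using le pq p q by auto
    obtain t where t: "is_projection t" "\<phi> t = \<phi> p * \<phi> q" using sur pmB \<phi>(1) by blast
    have "\<phi> t * \<phi> p = \<phi> t" "\<phi> t * \<phi> q = \<phi> t"
      unfolding t using \<phi>(1) comB by (metis is_projection_def mult.assoc)+
    then have "t * p = t" "t * q = t" using le t p q by auto
    then have "t * (p * q) = t" by (simp flip: mult.assoc)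
    then have "\<phi> t * \<phi> (p * q) = \<phi> t" using le t pq by auto
    moreover have "\<phi> (p * q) * \<phi> t = \<phi> (p * q)" unfolding t using 1 by (simp flip: mult.assoc)
    ultimately show ?thesis using t comB by metis
  qed
  have zero: "\<phi> p = 0 \<longleftrightarrow> p = 0" if "is_projection p" for p
    using inj[OF that is_projection_zero] z by auto
  have compl: "\<phi> (1 - p) = 1 - \<phi> p" if p: "is_projection p" for p
  proof -
    have p': "is_projection (1 - p)" using p by (rule is_projection_complement)
    have "\<phi> p * \<phi> (1 - p) = 0" using mult[OF p p'] idem[OF p] z by simp
    then have u: "(1 - \<phi> p) * \<phi> (1 - p) = \<phi> (1 - p)" by (simp add: left_diff_distrib)
    \<comment> \<open>The preimage \<open>t\<close> of the complement is disjoint from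
      \<open>p\<close>, hence below \<open>1 - p\<close>; this gives the inequality opposite to
      \<open>u\<close>.\<close>
    obtain t where t: "is_projection t" "\<phi> t = 1 - \<phi> p" using sur is_projection_complement \<phi>(1) by blast
    have "\<phi> (t * p) = 0" using mult[OF t(1) p] t(2) idem[OF \<phi>(1)[of p]] comB by metis
    then have "t * p = 0" using zero pm t p by blast
    then have "t * (1 - p) = t" by (simp add: right_diff_distrib)
    then show ?thesis using le[OF t(1) p'] t(2) u by simp
  qed
  show ?thesis by (rule that[of \<phi>]) (use \<phi>(1) sur zero mult compl in auto)
qed

section \<open>Extending a Boolean isomorphism of projections\<close>

text \<open>Lists serve as formal linear combinations: one list is evaluated both with the identity
  and with \<open>\<phi>\<close>, and independence of the representation comes later from the
  equality of norms.\<close>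

definition lin_comb :: "('a \<Rightarrow> 'b::cstar_algebra) \<Rightarrow> (complex \<times> 'a) list \<Rightarrow> 'b" where
  "lin_comb \<phi> L = (\<Sum>(c, p)\<leftarrow>L. scaleC c (\<phi> p))"

lemma lin_comb_simps [simp]:
  "lin_comb \<phi> [] = 0"
  "lin_comb \<phi> ((c, p) # L) = scaleC c (\<phi> p) + lin_comb \<phi> L"
  "lin_comb \<phi> (L @ K) = lin_comb \<phi> L + lin_comb \<phi> K"
  by (simp_all add: lin_comb_def)

lemma scaleC_zero_right [simp]: "scaleC c (0::'a::cstar_algebra) = 0"
  using scaleC_add_right[of c "0::'a" 0] by simp

text \<open>With \<open>M\<close> the maximum and \<open>w = cstar z * z\<close>, the C*-identity
  gives the bounds \<open>- M^2\<close> and \<open>M^2\<close> for \<open>w\<close> after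
  multiplication by \<open>p\<close> and by \<open>1 - p\<close>; these add up to a two-sided bound
  on the self-adjoint \<open>w\<close>.\<close>

lemma norm_split_projection:
  fixes z p :: "'a::cstar_algebra"
  assumes com: "\<And>x y :: 'a. x * y = y * x" and p: "is_projection p"
  shows "norm z = max (norm (p * z)) (norm ((1 - p) * z))" (is "_ = ?M")
proof (rule antisym)
  have p': "is_projection (1 - p)" using p by (rule is_projection_complement)
  have le: "norm (q * z) \<le> norm z" if "is_projection q" for q
    using norm_mult_ineq[of q z] mult_right_mono[OF norm_projection_le[OF that] norm_ge_zero[of z]] by simp
  then show "?M \<le> norm z" using p p' by simp
  define w where "w = cstar z * z"
  have wsa: "cstar w = w" by (simp add: w_def cstar_simps)
  have part: "positive_el (q * (?M\<^sup>2 *\<^sub>R 1 - w)) \<and> positive_el (q * (?M\<^sup>2 *\<^sub>R 1 + w))"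
    if q: "is_projection q" and M: "norm (q * z) \<le> ?M" for q
  proof -
    have qq: "q * q = q" "cstar q = q" using q by (auto simp: is_projection_def)
    have "cstar (q * z) * (q * z) = q * w"
      by (simp add: w_def cstar_mult qq) (metis com mult.assoc qq(1))
    then have "norm (q * w) = (norm (q * z))\<^sup>2" using cstar_identity[of "q * z"] by simp
    then have n: "norm (q * w) \<le> ?M\<^sup>2" using M by (simp add: power_mono)
    have sa: "cstar (q * w) = q * w" using wsa qq com by (simp add: cstar_mult)
    have "positive_el (?M\<^sup>2 *\<^sub>R 1 - q * w)" using n sa by (intro positive_el_norm_diff)
    then have 1: "positive_el (q * (?M\<^sup>2 *\<^sub>R 1 - q * w))"
      using q com positive_el_mult positive_el_projection by blast
    have "positive_el (?M\<^sup>2 *\<^sub>R 1 - (- (q * w)))" using n sa by (intro positive_el_norm_diff) (auto simp: cstar_minus)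
    then have 2: "positive_el (q * (?M\<^sup>2 *\<^sub>R 1 - (- (q * w))))"
      using q com positive_el_mult positive_el_projection by blast
    have "q * (q * w) = q * w" by (simp add: qq flip: mult.assoc)
    then show ?thesis using 1 2 by (simp add: algebra_simps)
  qed
  have 1: "positive_el (p * (?M\<^sup>2 *\<^sub>R 1 - w))" "positive_el (p * (?M\<^sup>2 *\<^sub>R 1 + w))"
    using part[OF p] by auto
  have 2: "positive_el ((1 - p) * (?M\<^sup>2 *\<^sub>R 1 - w))" "positive_el ((1 - p) * (?M\<^sup>2 *\<^sub>R 1 + w))"
    using part[OF p'] by auto
  have "norm w \<le> ?M\<^sup>2"
  proof (rule norm_le_two_sided[OF _ _ _ wsa])
    show "positive_el (?M\<^sup>2 *\<^sub>R 1 - w)" using positive_el_add[OF 1(1) 2(1)] by (simp flip: distrib_right)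
    show "positive_el (?M\<^sup>2 *\<^sub>R 1 + w)" using positive_el_add[OF 1(2) 2(2)] by (simp flip: distrib_right)
  qed simp
  then have "(norm z)\<^sup>2 \<le> ?M\<^sup>2" unfolding w_def cstar_identity .
  then show "norm z \<le> ?M" by (rule power2_le_imp_le) (simp add: le_max_iff_disj)
qed

lemma bounded_linear_scaleC: "bounded_linear (scaleC c :: 'a::cstar_algebra \<Rightarrow> 'a)"
  by (rule bounded_linear_intro[of _ "cmod c"])
    (simp_all add: scaleC_add_right scaleR_scaleC scaleC_scaleC norm_scaleC mult.commute)

text \<open>On \<open>q\<close> the term \<open>scaleC c q\<close> acts as the scalar
  \<open>c\<close> and on \<open>1 - q\<close> it vanishes, so it is absorbed into the scalar
  \<open>\<mu>\<close>.\<close>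

lemma norm_split_scaleC:
  fixes x q S :: "'a::cstar_algebra"
  assumes com: "\<And>x y :: 'a. x * y = y * x" and q: "is_projection q"
  shows "norm (x * (scaleC \<mu> 1 + (scaleC c q + S))) =
    max (norm (x * q * (scaleC (\<mu> + c) 1 + S))) (norm (x * (1 - q) * (scaleC \<mu> 1 + S)))"
proof -
  have qq: "q * q = q" using q by (simp add: is_projection_def)
  have "q * (x * (scaleC \<mu> 1 + (scaleC c q + S))) = x * (q * (scaleC \<mu> 1 + (scaleC c q + S)))"
    by (metis com mult.assoc)
  also have "\<dots> = x * q * (scaleC (\<mu> + c) 1 + S)"
    by (simp add: distrib_left mult_scaleC_right qq scaleC_add_left mult.assoc add.assoc)
  finally have 1: "q * (x * (scaleC \<mu> 1 + (scaleC c q + S))) = x * q * (scaleC (\<mu> + c) 1 + S)" .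
  have "(1 - q) * (x * (scaleC \<mu> 1 + (scaleC c q + S))) = x * ((1 - q) * (scaleC \<mu> 1 + (scaleC c q + S)))"
    by (metis com mult.assoc)
  also have "\<dots> = x * (1 - q) * (scaleC \<mu> 1 + S)"
    by (simp add: distrib_left left_diff_distrib right_diff_distrib mult_scaleC_right qq mult.assoc)
  finally have 2: "(1 - q) * (x * (scaleC \<mu> 1 + (scaleC c q + S))) = x * (1 - q) * (scaleC \<mu> 1 + S)" .
  show ?thesis by (subst norm_split_projection[OF com q]) (simp only: 1 2)
qed

text \<open>Splitting along the projection of the first term removes it alike on both sides,
  changing only \<open>e\<close> and \<open>\<mu>\<close>, which are therefore part of the
  statement. In the end \<open>e\<close> times a scalar is left, whose norm depends only on
  \<open>\<mu>\<close> and on whether \<open>e\<close> is zero.\<close>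

lemma norm_lin_comb:
  fixes \<phi> :: "'a::cstar_algebra \<Rightarrow> 'b::cstar_algebra"
  assumes comA: "\<And>x y :: 'a. x * y = y * x" and comB: "\<And>x y :: 'b. x * y = y * x"
    and \<phi>: "\<And>p. is_projection p \<Longrightarrow> is_projection (\<phi> p)"
    "\<And>p. is_projection p \<Longrightarrow> \<phi> p = 0 \<longleftrightarrow> p = 0"
    "\<And>p q. is_projection p \<Longrightarrow> is_projection q \<Longrightarrow> \<phi> (p * q) = \<phi> p * \<phi> q"
    "\<And>p. is_projection p \<Longrightarrow> \<phi> (1 - p) = 1 - \<phi> p"
    and "is_projection e" "\<forall>(c, p)\<in>set L. is_projection p"
  shows "norm (e * (scaleC \<mu> 1 + lin_comb (\<lambda>p. p) L)) = norm (\<phi> e * (scaleC \<mu> 1 + lin_comb \<phi> L))"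
  using assms(7,8)
proof (induction L arbitrary: e \<mu>)
  case Nil
  then show ?case
    using \<phi>(1,2)[of e] norm_projection_nonzero[of e] norm_projection_nonzero[of "\<phi> e"]
    by (cases "e = 0") (auto simp: mult_scaleC_right norm_scaleC)
next
  case (Cons cp L)
  obtain c p where cp: "cp = (c, p)" by force
  have p: "is_projection p" and L: "\<forall>(c, p)\<in>set L. is_projection p" using Cons.prems cp by auto
  have p': "is_projection (1 - p)" using p by (rule is_projection_complement)
  note pm = is_projection_mult[OF comA]
  note e = Cons.prems(1)
  have "norm (e * (scaleC \<mu> 1 + (scaleC c p + lin_comb (\<lambda>p. p) L))) =
      norm (\<phi> e * (scaleC \<mu> 1 + (scaleC c (\<phi> p) + lin_comb \<phi> L)))"
    unfolding norm_split_scaleC[OF comA p] norm_split_scaleC[OF comB \<phi>(1)[OF p]]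
      Cons.IH[OF pm[OF e p] L] Cons.IH[OF pm[OF e p'] L] \<phi>(3)[OF e p] \<phi>(3)[OF e p'] \<phi>(4)[OF p] ..
  then show ?case by (simp add: cp)
qed

section \<open>Closures of isometric graphs\<close>

text \<open>First components approximating \<open>x\<close> form a Cauchy sequence, and by isometry
  so do the second ones. Stated for relations, this also applies to the converse of
  \<open>G\<close>.\<close>

lemma closure_graph_total:
  fixes G :: "('a::cstar_algebra \<times> 'b::cstar_algebra) set"
  assumes diff: "\<And>a b a' b'. (a, b) \<in> G \<Longrightarrow> (a', b') \<in> G \<Longrightarrow> (a - a', b - b') \<in> G"
    and iso: "\<And>a b. (a, b) \<in> G \<Longrightarrow> norm a = norm b"
    and dense: "\<And>x e. 0 < e \<Longrightarrow> \<exists>(a, b)\<in>G. norm (x - a) < e"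
  shows "\<exists>y X Y. (\<forall>n. (X n, Y n) \<in> G) \<and> X \<longlonglongrightarrow> x \<and> Y \<longlonglongrightarrow> y"
proof -
  have "\<exists>a b. (a, b) \<in> G \<and> norm (x - a) < inverse (real (Suc n))" for n
    using dense[of "inverse (real (Suc n))" x] by auto
  then obtain X Y where XY: "\<And>n. (X n, Y n) \<in> G" "\<And>n. norm (x - X n) < inverse (real (Suc n))"
    by metis
  have "(\<lambda>n. X n - x) \<longlonglongrightarrow> 0"
    by (rule LIMSEQ_norm_0) (use XY(2) in \<open>simp add: norm_minus_commute inverse_eq_divide\<close>)
  then have X: "X \<longlonglongrightarrow> x" by (simp add: LIM_zero_iff)
  have "norm (Y m - Y n) = norm (X m - X n)" for m n using iso[OF diff[OF XY(1) XY(1)]] by simp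
  moreover have "Cauchy X" using X LIMSEQ_imp_Cauchy by blast
  ultimately have "Cauchy Y" by (simp add: Cauchy_iff)
  then obtain y where "Y \<longlonglongrightarrow> y" using Cauchy_convergent convergent_def by blast
  then show ?thesis using XY(1) X by blast
qed

text \<open>The closure \<open>R\<close> of \<open>G\<close> inherits the operations and the
  isometry, hence is single-valued and injective, while density makes it total and onto. It is the
  graph of the desired map, which is even multiplicative.\<close>

lemma isometric_graph_extends:
  fixes G :: "('a::cstar_algebra \<times> 'b::cstar_algebra) set"
  assumes add: "\<And>a b a' b'. (a, b) \<in> G \<Longrightarrow> (a', b') \<in> G \<Longrightarrow> (a + a', b + b') \<in> G"
    and scale: "\<And>c a b. (a, b) \<in> G \<Longrightarrow> (scaleC c a, scaleC c b) \<in> G"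
    and mult: "\<And>a b a' b'. (a, b) \<in> G \<Longrightarrow> (a', b') \<in> G \<Longrightarrow> (a * a', b * b') \<in> G"
    and star: "\<And>a b. (a, b) \<in> G \<Longrightarrow> (cstar a, cstar b) \<in> G"
    and iso: "\<And>a b. (a, b) \<in> G \<Longrightarrow> norm a = norm b"
    and dense1: "\<And>x e. 0 < e \<Longrightarrow> \<exists>(a, b)\<in>G. norm (x - a) < e"
    and dense2: "\<And>y e. 0 < e \<Longrightarrow> \<exists>(a, b)\<in>G. norm (y - b) < e"
  shows "\<exists>J :: 'a \<Rightarrow> 'b. jordan_star_iso J"
proof -
  define R where "R x y \<longleftrightarrow> (\<exists>X Y. (\<forall>n. (X n, Y n) \<in> G) \<and> X \<longlonglongrightarrow> x \<and> Y \<longlonglongrightarrow> y)" for x y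
  have diff: "(a - a', b - b') \<in> G" if "(a, b) \<in> G" "(a', b') \<in> G" for a b a' b'
  proof -
    show ?thesis using add[OF that(1) scale[OF that(2), of "-1"]] by (simp add: scaleC_minus_one)
  qed
  have total: "\<exists>y. R x y" for x unfolding R_def using closure_graph_total[OF diff iso dense1, of x] by blast
  have onto: "\<exists>x. R x y" for y
  proof -
    have "\<exists>x Y X. (\<forall>n. (Y n, X n) \<in> G\<inverse>) \<and> Y \<longlonglongrightarrow> y \<and> X \<longlonglongrightarrow> x"
      using diff iso[symmetric] dense2 by (intro closure_graph_total) fastforce+
    then show ?thesis unfolding R_def by auto
  qed
  have Radd: "R (x + x') (y + y')" if xy: "R x y" "R x' y'" for x x' y y'
  proof -
    obtain X Y X' Y' where "\<forall>n. (X n, Y n) \<in> G" "X \<longlonglongrightarrow> x" "Y \<longlonglongrightarrow> y"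
      "\<forall>n. (X' n, Y' n) \<in> G" "X' \<longlonglongrightarrow> x'" "Y' \<longlonglongrightarrow> y'" using xy unfolding R_def by blast
    then show ?thesis unfolding R_def
      by (intro exI[of _ "\<lambda>n. X n + X' n"] exI[of _ "\<lambda>n. Y n + Y' n"]) (auto intro!: tendsto_add add)
  qed
  have Rmult: "R (x * x') (y * y')" if xy: "R x y" "R x' y'" for x x' y y'
  proof -
    obtain X Y X' Y' where "\<forall>n. (X n, Y n) \<in> G" "X \<longlonglongrightarrow> x" "Y \<longlonglongrightarrow> y"
      "\<forall>n. (X' n, Y' n) \<in> G" "X' \<longlonglongrightarrow> x'" "Y' \<longlonglongrightarrow> y'" using xy unfolding R_def by blast
    then show ?thesis unfolding R_def
      by (intro exI[of _ "\<lambda>n. X n * X' n"] exI[of _ "\<lambda>n. Y n * Y' n"]) (auto intro!: tendsto_mult mult)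
  qed
  have Rstar: "R (cstar x) (cstar y)" if xy: "R x y" for x y
  proof -
    obtain X Y where "\<forall>n. (X n, Y n) \<in> G" "X \<longlonglongrightarrow> x" "Y \<longlonglongrightarrow> y" using xy unfolding R_def by blast
    then show ?thesis unfolding R_def
      by (intro exI[of _ "\<lambda>n. cstar (X n)"] exI[of _ "\<lambda>n. cstar (Y n)"])
        (auto intro!: bounded_linear.tendsto[OF bounded_linear_cstar] star)
  qed
  have Rscale: "R (scaleC c x) (scaleC c y)" if xy: "R x y" for c x y
  proof -
    obtain X Y where "\<forall>n. (X n, Y n) \<in> G" "X \<longlonglongrightarrow> x" "Y \<longlonglongrightarrow> y" using xy unfolding R_def by blast
    then show ?thesis unfolding R_def
      by (intro exI[of _ "\<lambda>n. scaleC c (X n)"] exI[of _ "\<lambda>n. scaleC c (Y n)"])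
        (auto intro!: bounded_linear.tendsto[OF bounded_linear_scaleC] scale)
  qed
  have Rnorm: "norm x = norm y" if xy: "R x y" for x y
  proof -
    obtain X Y where *: "\<forall>n. (X n, Y n) \<in> G" "X \<longlonglongrightarrow> x" "Y \<longlonglongrightarrow> y" using xy unfolding R_def by blast
    then have "(\<lambda>n. norm (X n)) = (\<lambda>n. norm (Y n))" using iso by blast
    then show ?thesis using tendsto_norm[OF *(2)] tendsto_norm[OF *(3)] LIMSEQ_unique by metis
  qed
  have Rdiff: "norm (x - x') = norm (y - y')" if "R x y" "R x' y'" for x x' y y'
  proof -
    show ?thesis using Rnorm[OF Radd[OF that(1) Rscale[OF that(2), of "-1"]]] by (simp add: scaleC_minus_one)
  qed
  obtain J where J: "\<And>x. R x (J x)" using total by metis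
  have uniq: "J x = y" if "R x y" for x y using Rdiff[OF J[of x] that] by simp
  have "bij J"
  proof (rule bijI)
    show "inj J" using Rdiff[OF J J] by (intro injI) (metis norm_eq_zero right_minus_eq)
    show "surj J" using onto uniq by (metis surjI)
  qed
  then show ?thesis unfolding jordan_star_iso_def
    by (intro exI[of _ J] conjI allI uniq) (auto intro!: Radd Rscale Rstar Rmult J)
qed

lemma jordan_star_iso_of_boolean_isomorphism:
  fixes \<phi> :: "'a::cstar_algebra \<Rightarrow> 'b::cstar_algebra"
  assumes AWA: "AW_star TYPE('a)" and AWB: "AW_star TYPE('b)"
    and comA: "\<And>x y :: 'a. x * y = y * x" and comB: "\<And>x y :: 'b. x * y = y * x"
    and \<phi>: "\<And>p. is_projection p \<Longrightarrow> is_projection (\<phi> p)"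
    "\<And>p. is_projection p \<Longrightarrow> \<phi> p = 0 \<longleftrightarrow> p = 0"
    "\<And>p q. is_projection p \<Longrightarrow> is_projection q \<Longrightarrow> \<phi> (p * q) = \<phi> p * \<phi> q"
    "\<And>p. is_projection p \<Longrightarrow> \<phi> (1 - p) = 1 - \<phi> p"
    and surj: "\<And>r. is_projection r \<Longrightarrow> \<exists>p. is_projection p \<and> \<phi> p = r"
  shows "\<exists>J :: 'a \<Rightarrow> 'b. jordan_star_iso J"
proof -
  let ?id = "\<lambda>p::'a. p"
  define valid where "valid L \<longleftrightarrow> (\<forall>(c, p)\<in>set L. is_projection p)" for L :: "(complex \<times> 'a) list"
  define G where "G = {(lin_comb ?id L, lin_comb \<phi> L) | L. valid L}"
  note pm = is_projection_mult[OF comA]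
  have proj: "(p, \<phi> p) \<in> G" if "is_projection p" for p
    unfolding G_def using that
    by (intro CollectI exI[of _ "[(1, p)]"]) (simp add: valid_def scaleC_one)
  have add: "(a + a', b + b') \<in> G" if ab: "(a, b) \<in> G" "(a', b') \<in> G" for a b a' b'
  proof -
    obtain L K where "valid L" "valid K" "a = lin_comb ?id L" "b = lin_comb \<phi> L"
      "a' = lin_comb ?id K" "b' = lin_comb \<phi> K" using ab unfolding G_def by blast
    then show ?thesis unfolding G_def by (intro CollectI exI[of _ "L @ K"]) (auto simp: valid_def)
  qed
  have zero: "(0, 0) \<in> G" unfolding G_def by (intro CollectI exI[of _ "[]"]) (simp add: valid_def)
  have ind: "P a b" if ab: "(a, b) \<in> G" and "P 0 0"
      and "\<And>c p a b. is_projection p \<Longrightarrow> (a, b) \<in> G \<Longrightarrow> P a b \<Longrightarrow> P (scaleC c p + a) (scaleC c (\<phi> p) + b)"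
    for a b and P :: "'a \<Rightarrow> 'b \<Rightarrow> bool"
  proof -
    have "valid L \<Longrightarrow> P (lin_comb ?id L) (lin_comb \<phi> L)" for L
    proof (induction L)
      case (Cons cp L)
      obtain c p where cp: "cp = (c, p)" by force
      have "is_projection p" "valid L" using Cons.prems by (auto simp: valid_def cp)
      moreover from this(2) have "(lin_comb ?id L, lin_comb \<phi> L) \<in> G" unfolding G_def by blast
      ultimately show ?case using that(3) Cons.IH by (simp add: cp)
    qed (use that(2) in simp)
    then show ?thesis using ab unfolding G_def by blast
  qed
  have scale_proj: "(scaleC c p, scaleC c (\<phi> p)) \<in> G" if "is_projection p" for c p
    unfolding G_def using that by (intro CollectI exI[of _ "[(c, p)]"]) (simp add: valid_def)
  have scale: "(scaleC c a, scaleC c b) \<in> G" if "(a, b) \<in> G" for c a b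
    using that by (rule ind) (auto simp: zero scaleC_add_right scaleC_scaleC intro!: add scale_proj)
  have star: "(cstar a, cstar b) \<in> G" if "(a, b) \<in> G" for a b
    using that
  proof (rule ind)
    fix c :: complex and p a :: 'a and b :: 'b assume p: "is_projection p" and *: "(cstar a, cstar b) \<in> G"
    have "cstar p = p" "cstar (\<phi> p) = \<phi> p" using p \<phi>(1) by (auto simp: is_projection_def)
    then show "(cstar (scaleC c p + a), cstar (scaleC c (\<phi> p) + b)) \<in> G"
      using add[OF scale_proj[OF p] *] by (simp add: cstar_add cstar_scaleC)
  qed (simp add: zero)
  have mult_proj: "(q * a, \<phi> q * b) \<in> G" if "is_projection q" "(a, b) \<in> G" for q a b
    using that(2)
  proof (rule ind)
    fix c :: complex and p a :: 'a and b :: 'b assume p: "is_projection p" and *: "(q * a, \<phi> q * b) \<in> G"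
    show "(q * (scaleC c p + a), \<phi> q * (scaleC c (\<phi> p) + b)) \<in> G"
      using add[OF scale_proj[OF pm[OF that(1) p]] *] \<phi>(3)[OF that(1) p]
      by (simp add: distrib_left mult_scaleC_right)
  qed (simp add: zero)
  have mult: "(a * a', b * b') \<in> G" if "(a, b) \<in> G" "(a', b') \<in> G" for a b a' b'
    using that(1)
  proof (rule ind)
    fix c :: complex and p a :: 'a and b :: 'b assume p: "is_projection p" and *: "(a * a', b * b') \<in> G"
    show "((scaleC c p + a) * a', (scaleC c (\<phi> p) + b) * b') \<in> G"
      using add[OF scale[OF mult_proj[OF p that(2)]] *] by (simp add: distrib_right mult_scaleC_left)
  qed (simp add: zero)
  \<comment> \<open>The choice \<open>e = 1\<close>, \<open>\<mu> = 0\<close> specializes the norm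
    equality to plain combinations.\<close>
  have "norm (1 * (scaleC 0 1 + lin_comb ?id L)) = norm (\<phi> 1 * (scaleC 0 1 + lin_comb \<phi> L))"
    if "valid L" for L
    by (rule norm_lin_comb[where \<phi> = \<phi>, OF comA comB \<phi> is_projection_one])
      (use that in \<open>simp_all add: valid_def\<close>)
  moreover have "\<phi> 1 = 1" using \<phi>(4)[of 0] \<phi>(2)[of 0] by simp
  moreover have "scaleC 0 (1::'a) = 0" "scaleC 0 (1::'b) = 0"
    using scaleR_scaleC[of 0 "1::'a"] scaleR_scaleC[of 0 "1::'b"] by simp_all
  ultimately have iso: "norm a = norm b" if "(a, b) \<in> G" for a b
    using that by (auto simp: G_def)
  have subspace: "x + y \<in> fst ` G" if "x \<in> fst ` G" "y \<in> fst ` G" for x y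
    using that add by (auto simp: image_iff Bex_def) blast
  have subspace_snd: "x + y \<in> snd ` G" if "x \<in> snd ` G" "y \<in> snd ` G" for x y
    using that add by (auto simp: image_iff Bex_def) blast
  have cone: "scaleC c x \<in> fst ` G" if "x \<in> fst ` G" for c x
    using that scale by (auto simp: image_iff Bex_def)
  have cone_snd: "scaleC c x \<in> snd ` G" if "x \<in> snd ` G" for c x
    using that scale by (auto simp: image_iff Bex_def)
  have dense1: "\<exists>(a, b)\<in>G. norm (x - a) < e" if e: "0 < e" for x e
  proof -
    have "p \<in> fst ` G" if "is_projection p" for p using proj[OF that] by (rule image_eqI[rotated]) simp
    then have "\<exists>s\<in>fst ` G. norm (x - s) < e" using AW_star_dense[OF AWA _ subspace cone e] by blast
    then show ?thesis by auto
  qed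
  have dense2: "\<exists>(a, b)\<in>G. norm (y - b) < e" if e: "0 < e" for y e
  proof -
    have "r \<in> snd ` G" if r: "is_projection r" for r
    proof -
      obtain p where p: "is_projection p" "\<phi> p = r" using surj[OF r] by blast
      show ?thesis using proj[OF p(1)] by (rule image_eqI[rotated]) (simp add: p)
    qed
    then have "\<exists>s\<in>snd ` G. norm (y - s) < e" using AW_star_dense[OF AWB _ subspace_snd cone_snd e] by blast
    then show ?thesis by auto
  qed
  show ?thesis by (rule isometric_graph_extends[where G = G, OF add scale mult star iso dense1 dense2])
qed

section \<open>The converse\<close>

lemma positive_el_inverse:
  fixes y b :: "'a::cstar_algebra"
  assumes "positive_el y" "y * b = 1" "b * y = 1"
  shows "positive_el b"
proof -
  have "cstar b = b" using cstar_inverse[OF assms(2,3)] positive_el_self_adjoint[OF assms(1)] .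
  then have "positive_el (y * (b * b))"
    using assms by (intro positive_el_mult positive_el_square) (simp_all add: mult.assoc flip: mult.assoc[of y])
  then show ?thesis using assms(2) by (simp flip: mult.assoc)
qed

text \<open>The order isomorphism \<open>h \<mapsto> h + \<surd>(1 + h\<^sup>2)\<close> has the inverse \<open>y \<mapsto> (y - y\<inverse>) / 2\<close>; it plays
  the role of the exponential.\<close>

lemma positive_inverse_difference:
  fixes h :: "'a::cstar_algebra"
  assumes com: "\<And>x y :: 'a. x * y = y * x" and h: "cstar h = h"
  obtains y b where "y \<in> positive_invertible_part" "y * b = 1" "y - b = 2 *\<^sub>R h"
proof -
  have "positive_el (1 + h * h)" using h by (intro positive_el_add positive_el_square) auto
  then obtain r where r: "cstar r = r" "r * r = 1 + h * h" "positive_el r"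
    by (rule positive_el_sqrt) blast
  let ?y = "h + r" and ?b = "r - h"
  have yb: "?y * ?b = 1" using r(2) com[of h r] by (simp add: algebra_simps)
  have inv: "invertible_el ?y" using yb com by (metis invertible_elI)
  have "positive_el ?y"
  proof (rule positive_elI_invertible)
    show "cstar ?y = ?y" using h r by (simp add: cstar_add)
    fix e :: real assume e: "0 < e"
    \<comment> \<open>As \<open>?y + ?b = 2 r\<close> is positive, this product is at least 1, hence
      invertible, and so is its factor.\<close>
    have "(?y + e *\<^sub>R 1) * (?b + e *\<^sub>R 1) = ?y * ?b + e *\<^sub>R (?y + ?b) + (e * e) *\<^sub>R 1"
      by (simp add: algebra_simps)
    also have "\<dots> - 1 *\<^sub>R 1 = e *\<^sub>R (r + r) + (e * e) *\<^sub>R 1" unfolding yb by simp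
    finally have "positive_el ((?y + e *\<^sub>R 1) * (?b + e *\<^sub>R 1) - 1 *\<^sub>R 1)"
      using r(3) e by (simp add: positive_el_add positive_el_scaleR)
    then have "(?y + e *\<^sub>R 1) * (?b + e *\<^sub>R 1) \<in> positive_invertible_part"
      using positive_invertible_part_iff zero_less_one by blast
    then show "invertible_el (?y + e *\<^sub>R 1)"
      using invertible_el_left_factor[OF com] unfolding positive_invertible_part_def by blast
  qed
  then have "?y \<in> positive_invertible_part" using inv by (simp add: positive_invertible_part_def)
  moreover have "?y - ?b = 2 *\<^sub>R h" by (simp add: scaleR_2)
  ultimately show ?thesis using that yb by blast
qed

text \<open>The identity \<open>(z - y) * (1 + b * c) = (z - c) - (y - b)\<close> relates both sides
  by a positive factor whose inverse is positive too.\<close>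

lemma le_iff_inverse_difference_le:
  fixes y z b c :: "'a::cstar_algebra"
  assumes com: "\<And>x y :: 'a. x * y = y * x"
    and y: "y \<in> positive_invertible_part" "y * b = 1" and z: "z \<in> positive_invertible_part" "z * c = 1"
  shows "positive_el (z - y) \<longleftrightarrow> positive_el ((z - c) - (y - b))"
proof -
  have "positive_el b" "positive_el c"
    using y z com positive_el_inverse unfolding positive_invertible_part_def by (metis mem_Collect_eq)+
  then have bc: "positive_el (b * c)" using com positive_el_mult by blast
  let ?k = "1 + b * c"
  have "positive_el (?k - 1 *\<^sub>R 1)" using bc by simp
  then have k: "?k \<in> positive_invertible_part" using positive_invertible_part_iff zero_less_one by blast
  then obtain j where j: "?k * j = 1" by (auto simp: positive_invertible_part_def invertible_el_def)
  have kpos: "positive_el ?k" using k by (simp add: positive_invertible_part_def)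
  then have jpos: "positive_el j" using positive_el_inverse j com by metis
  have "z * (b * c) = b" "y * (b * c) = c"
    using y(2) z(2) com by (metis mult.assoc mult_1_right mult_1_left)+
  then have eq: "(z - y) * ?k = (z - c) - (y - b)" by (simp add: algebra_simps)
  have eq': "((z - c) - (y - b)) * j = z - y" unfolding eq[symmetric] using j by (simp add: mult.assoc)
  show ?thesis
  proof
    assume "positive_el (z - y)"
    then have "positive_el ((z - y) * ?k)" using kpos com positive_el_mult by blast
    then show "positive_el ((z - c) - (y - b))" unfolding eq .
  next
    assume "positive_el ((z - c) - (y - b))"
    then have "positive_el (((z - c) - (y - b)) * j)" using jpos com positive_el_mult by blast
    then show "positive_el (z - y)" unfolding eq' .
  qed
qed

lemma commutative_order_isomorphic:
  assumes com: "\<And>x y :: 'a::cstar_algebra. x * y = y * x"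
  shows "order_isomorphic (self_adjoint_part :: 'a set) (positive_invertible_part :: 'a set)"
proof -
  have "\<exists>y b. y \<in> positive_invertible_part \<and> y * b = 1 \<and> y - b = 2 *\<^sub>R h"
    if "h \<in> self_adjoint_part" for h :: 'a
    by (rule positive_inverse_difference[OF com, of h]) (use that in \<open>auto simp: self_adjoint_part_def\<close>)
  then obtain f i where f: "\<And>h. h \<in> self_adjoint_part \<Longrightarrow>
      f h \<in> positive_invertible_part \<and> f h * i h = 1 \<and> f h - i h = 2 *\<^sub>R (h::'a)"
    by metis
  have pos2: "positive_el (2 *\<^sub>R u - 2 *\<^sub>R v) \<longleftrightarrow> positive_el (u - v)" for u v :: 'a
    using positive_el_scaleR_iff[of 2 "u - v"] by (simp add: scaleR_diff_right)
  have ord: "cstar_le x y \<longleftrightarrow> cstar_le (f x) (f y)"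
    if "x \<in> self_adjoint_part" "y \<in> self_adjoint_part" for x y
    using le_iff_inverse_difference_le[OF com, of "f x" "i x" "f y" "i y"] f[OF that(1)] f[OF that(2)]
    by (simp add: cstar_le_def pos2)
  have "inj_on f self_adjoint_part"
  proof
    fix x y assume xy: "x \<in> self_adjoint_part" "y \<in> self_adjoint_part" "f x = f y"
    then have "positive_el (y - x)" "positive_el (x - y)"
      using ord[OF xy(1,2)] ord[OF xy(2,1)] by (simp_all add: cstar_le_def)
    then show "x = y" using positive_el_antisym[of "y - x"] by simp
  qed
  moreover have "f ` self_adjoint_part = positive_invertible_part"
  proof (intro antisym subsetI)
    fix y :: 'a assume y: "y \<in> positive_invertible_part"
    then obtain b where b: "y * b = 1" "b * y = 1" by (auto simp: positive_invertible_part_def invertible_el_def)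
    have "cstar y = y" using y positive_el_self_adjoint by (auto simp: positive_invertible_part_def)
    moreover from this have "cstar b = b" using cstar_inverse b by blast
    ultimately have h: "(1/2) *\<^sub>R (y - b) \<in> self_adjoint_part" by (simp add: self_adjoint_part_def cstar_simps)
    let ?z = "f ((1/2) *\<^sub>R (y - b))" and ?c = "i ((1/2) *\<^sub>R (y - b))"
    have z: "?z \<in> positive_invertible_part" "?z * ?c = 1" "?z - ?c = y - b" using f[OF h] by auto
    have "positive_el (?z - y)" "positive_el (y - ?z)"
      using le_iff_inverse_difference_le[OF com y b(1) z(1,2)] le_iff_inverse_difference_le[OF com z(1,2) y b(1)] z(3)
      by simp_all
    then have "?z = y" using positive_el_antisym[of "?z - y"] by simp
    then show "y \<in> f ` self_adjoint_part" using h by force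
  qed (use f in blast)
  ultimately show ?thesis unfolding order_isomorphic_def bij_betw_def using ord by blast
qed

section \<open>Jordan isomorphisms preserve the order\<close>

text \<open>The Jordan identity preserves squares, and positive elements are the squares of
  self-adjoint ones, so positivity passes in both directions. Invertibility follows through the
  scalar lower bound, since the unit is preserved.\<close>

lemma jordan_star_iso_order_isomorphic:
  fixes J :: "'a::cstar_algebra \<Rightarrow> 'b::cstar_algebra"
  assumes "jordan_star_iso J"
  shows "bij_betw J positive_invertible_part positive_invertible_part"
    and "cstar_le x y \<longleftrightarrow> cstar_le (J x) (J y)"
proof -
  have bij: "bij J" and add: "\<And>x y. J (x + y) = J x + J y"
    and scale: "\<And>c x. J (scaleC c x) = scaleC c (J x)" and star: "\<And>a. J (cstar a) = cstar (J a)"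
    and jordan: "\<And>a b. J (a * b + b * a) = J a * J b + J b * J a"
    using assms by (auto simp: jordan_star_iso_def)
  have scaleR: "J (r *\<^sub>R x) = r *\<^sub>R J x" for r x by (simp add: scaleR_scaleC scale)
  have diff: "J (x - y) = J x - J y" for x y using add[of x "(-1) *\<^sub>R y"] scaleR[of "-1" y] by simp
  have double: "u = v" if "u + u = v + v" for u v :: 'b using that by (simp flip: scaleR_2)
  have sq: "J (x * x) = J x * J x" for x using jordan[of x x] add double by metis
  \<comment> \<open>The Jordan identity for \<open>1\<close> and \<open>u\<close> reads
    \<open>2 J u = 2 J 1\<close>.\<close>
  obtain u where "J u = 1" using bij by (metis bij_pointE)
  then have one: "J 1 = 1" using jordan[of 1 u] add double by (metis mult_1_left mult_1_right)
  have inj: "J x = J y \<longleftrightarrow> x = y" for x y using bij by (metis bij_def inj_eq)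
  have pos: "positive_el (J x) \<longleftrightarrow> positive_el x" for x
  proof
    assume "positive_el x"
    then obtain s where "cstar s = s" "s * s = x" by (rule positive_el_sqrt)
    then show "positive_el (J x)" using sq[of s] star[of s] positive_el_square[of "J s"] by simp
  next
    assume "positive_el (J x)"
    then obtain t where t: "cstar t = t" "t * t = J x" by (rule positive_el_sqrt)
    obtain s where s: "J s = t" using bij by (metis bij_pointE)
    have "cstar s = s" "s * s = x" using t s star[of s] sq[of s] inj by auto
    then show "positive_el x" using positive_el_square by blast
  qed
  show "cstar_le x y \<longleftrightarrow> cstar_le (J x) (J y)" by (simp add: cstar_le_def pos flip: diff)
  have "J x \<in> positive_invertible_part \<longleftrightarrow> x \<in> positive_invertible_part" for x
    unfolding positive_invertible_part_iff using pos[of "x - e *\<^sub>R 1" for e] by (simp add: diff scaleR one)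
  then show "bij_betw J positive_invertible_part positive_invertible_part"
    using bij unfolding bij_betw_def bij_def by (metis inj_on_subset subset_UNIV subsetI antisym image_subsetI surjD image_eqI)
qed

theorem theorem5p4:
  assumes "AW_star TYPE('a::cstar_algebra)"
    and "AW_star TYPE('b::cstar_algebra)"
  shows "order_isomorphic (self_adjoint_part :: 'a set) (positive_invertible_part :: 'b set)
         \<longleftrightarrow> (jordan_star_isomorphic TYPE('a) TYPE('b) \<and> commutative_alg TYPE('a))"
proof
  assume "order_isomorphic (self_adjoint_part :: 'a set) (positive_invertible_part :: 'b set)"
  then obtain f :: "'a \<Rightarrow> 'b" where bij: "bij_betw f self_adjoint_part positive_invertible_part"
    and ord: "\<And>x y. x \<in> self_adjoint_part \<Longrightarrow> y \<in> self_adjoint_part \<Longrightarrow> cstar_le x y \<longleftrightarrow> cstar_le (f x) (f y)"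
    unfolding order_isomorphic_def by blast
  have comB: "x * y = y * x" for x y :: 'b
    by (rule order_isomorphic_commutative_right[OF assms(2) bij ord])
  have comA: "x * y = y * x" for x y :: 'a
    by (rule order_isomorphic_commutative_left[OF assms(1) comB bij ord])
  note g = order_isomorphic_preserves_orthogonality[OF comA comB bij ord]
  have "\<exists>J :: 'a \<Rightarrow> 'b. jordan_star_iso J"
  proof (rule boolean_isomorphism_of_orthogonality[OF assms comA comB g])
    fix \<phi> :: "'a \<Rightarrow> 'b"
    assume \<phi>: "\<And>p. is_projection p \<Longrightarrow> is_projection (\<phi> p)"
      "\<And>r. is_projection r \<Longrightarrow> \<exists>p. is_projection p \<and> \<phi> p = r"
      "\<And>p. is_projection p \<Longrightarrow> \<phi> p = 0 \<longleftrightarrow> p = 0"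
      "\<And>p q. is_projection p \<Longrightarrow> is_projection q \<Longrightarrow> \<phi> (p * q) = \<phi> p * \<phi> q"
      "\<And>p. is_projection p \<Longrightarrow> \<phi> (1 - p) = 1 - \<phi> p"
    show ?thesis
      by (rule jordan_star_iso_of_boolean_isomorphism[OF assms comA comB \<phi>(1,3,4,5,2)])
  qed
  then show "jordan_star_isomorphic TYPE('a) TYPE('b) \<and> commutative_alg TYPE('a)"
    using comA by (simp add: jordan_star_isomorphic_def commutative_alg_def)
next
  assume "jordan_star_isomorphic TYPE('a) TYPE('b) \<and> commutative_alg TYPE('a)"
  then obtain J :: "'a \<Rightarrow> 'b" where J: "jordan_star_iso J" and com: "\<And>x y :: 'a. x * y = y * x"
    by (auto simp: jordan_star_isomorphic_def commutative_alg_def)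
  obtain f :: "'a \<Rightarrow> 'a" where f: "bij_betw f self_adjoint_part positive_invertible_part"
    "\<forall>x\<in>self_adjoint_part. \<forall>y\<in>self_adjoint_part. cstar_le x y \<longleftrightarrow> cstar_le (f x) (f y)"
    using commutative_order_isomorphic[OF com] unfolding order_isomorphic_def by blast
  have "bij_betw (J \<circ> f) self_adjoint_part positive_invertible_part"
    using bij_betw_trans[OF f(1) jordan_star_iso_order_isomorphic(1)[OF J]] .
  moreover have "\<forall>x\<in>self_adjoint_part. \<forall>y\<in>self_adjoint_part. cstar_le x y \<longleftrightarrow> cstar_le ((J \<circ> f) x) ((J \<circ> f) y)"
    using f(2) jordan_star_iso_order_isomorphic(2)[OF J] by simp
  ultimately show "order_isomorphic (self_adjoint_part :: 'a set) (positive_invertible_part :: 'b set)"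
    unfolding order_isomorphic_def by blast
qed

end
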